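(* For every real $\varepsilon$ with $0<\varepsilon\le 1$ there exists a constant $c=c(\varepsilon)\ge \varepsilon^{4}/640000$ such that, for all sufficiently large $n$ (depending on $\varepsilon$), every signing $\sigma\colon E(K_{n,n})\to\{-1,+1\}$ of the complete bipartite graph $K_{n,n}$ satisfies at least one of the following: (i) $K_{n,n}$ admits a $1$-factorization in which every perfect matching has discrepancy (with respect to $\sigma$) at least $c$; (ii) $\sigma$ is $\varepsilon$-close to some balanced one-sided signing.
   Context: $K_{n,n}=(X\cup Y,E)$ is the complete bipartite graph with parts $X=\{x_1,\dots,x_n\}$ and $Y=\{y_1,\dots,y_n\}$ of size $n$. A signing is a map $\sigma\colon E(K_{n,n})\to\{-1,+1\}$; its sign matrix $M_\sigma\in\{-1,+1\}^{n\times n}$ has $(i,j)$ entry $\sigma(x_iy_j)$. For a nonempty subgraph $H$ of $K_{n,n}$, $S_\sigma(H)=\sum_{e\in E(H)}\sigma(e)$, and the (normalized) discrepancy of $H$ is $\operatorname{disc}(H)=|S_\sigma(H)|/|E(H)|$. A $1$-factorization of a graph is a partition of its edge set into perfect matchings. $\mathbf 1$ denotes the all-ones column vector of length $n$. A vector $\mathbf z\in\{-1,+1\}^n$ is balanced if the numbers of its $+1$ and $-1$ entries differ by at most one. A signing $\sigma$ is a balanced one-sided signing if $M_\sigma=\mathbf z\mathbf 1^{T}$ or $M_\sigma=\mathbf 1\mathbf z^{T}$ for some balanced $\mathbf z\in\{-1,+1\}^n$. A signing $\sigma$ is $\varepsilon$-close to a signing $\sigma'$ if $M_\sigma$ and $M_{\sigma'}$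 differ in at most $\varepsilon n^2$ entries. *)

theory Defs
  imports Complex_Main "HOL-Library.Disjoint_Sets" "Jordan_Normal_Form.Matrix"
begin

text \<open>
  Simple graphs are given by a vertex set \<open>V\<close> and a set \<open>E\<close> of two-element edges.
  The vertices of \<open>K\<^bsub>n,n\<^esub>\<close> are \<open>Inl i\<close> (the part \<open>X\<close>) and \<open>Inr j\<close> (the part \<open>Y\<close>)
  with zero-based indices \<open>i, j < n\<close>, in agreement with the indexing of matrices.
\<close>

definition Knn_verts :: "nat \<Rightarrow> (nat + nat) set" where
  "Knn_verts n = Inl ` {..<n} \<union> Inr ` {..<n}"

definition Knn_edges :: "nat \<Rightarrow> (nat + nat) set set" where
  "Knn_edges n = {{Inl i, Inr j} | i j. i < n \<and> j < n}"

definition perfect_matching :: "'v set \<Rightarrow> 'v set set \<Rightarrow> 'v set set \<Rightarrow> bool" where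
  "perfect_matching V E M \<longleftrightarrow> M \<subseteq> E \<and> (\<forall>v\<in>V. \<exists>!e. e \<in> M \<and> v \<in> e)"

definition one_factorization :: "'v set \<Rightarrow> 'v set set \<Rightarrow> 'v set set set \<Rightarrow> bool" where
  "one_factorization V E F \<longleftrightarrow> partition_on E F \<and> (\<forall>M\<in>F. perfect_matching V E M)"

text \<open>Only the values of a signing on the edges of \<open>K\<^bsub>n,n\<^esub>\<close> are constrained or ever used.\<close>

definition signing :: "nat \<Rightarrow> ((nat + nat) set \<Rightarrow> int) \<Rightarrow> bool" where
  "signing n \<sigma> \<longleftrightarrow> (\<forall>e\<in>Knn_edges n. \<sigma> e \<in> {-1, 1})"

definition sign_matrix :: "nat \<Rightarrow> ((nat + nat) set \<Rightarrow> int) \<Rightarrow> int mat" where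
  "sign_matrix n \<sigma> = mat n n (\<lambda>(i, j). \<sigma> {Inl i, Inr j})"

text \<open>In the next two definitions a subgraph \<open>H\<close> is represented by its edge set.\<close>

definition signed_sum :: "('v set \<Rightarrow> int) \<Rightarrow> 'v set set \<Rightarrow> int" where
  "signed_sum \<sigma> H = (\<Sum>e\<in>H. \<sigma> e)"

definition discrepancy :: "('v set \<Rightarrow> int) \<Rightarrow> 'v set set \<Rightarrow> real" where
  "discrepancy \<sigma> H = real_of_int \<bar>signed_sum \<sigma> H\<bar> / real (card H)"

definition sign_vector :: "nat \<Rightarrow> int vec \<Rightarrow> bool" where
  "sign_vector n z \<longleftrightarrow> z \<in> carrier_vec n \<and> (\<forall>i<n. z $ i \<in> {-1, 1})"

definition balanced_vector :: "nat \<Rightarrow> int vec \<Rightarrow> bool" where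
  "balanced_vector n z \<longleftrightarrow> sign_vector n z \<and>
     \<bar>int (card {i. i < n \<and> z $ i = 1}) - int (card {i. i < n \<and> z $ i = -1})\<bar> \<le> 1"

definition ones_vec :: "nat \<Rightarrow> int vec" where
  "ones_vec n = vec n (\<lambda>_. 1)"

text \<open>The outer product \<open>u v\<^sup>T\<close>, as a product of an \<open>n \<times> 1\<close> and a \<open>1 \<times> n\<close> matrix.\<close>

definition outer :: "nat \<Rightarrow> int vec \<Rightarrow> int vec \<Rightarrow> int mat" where
  "outer n u v = mat_of_cols n [u] * transpose_mat (mat_of_cols n [v])"

definition balanced_one_sided :: "nat \<Rightarrow> ((nat + nat) set \<Rightarrow> int) \<Rightarrow> bool" where
  "balanced_one_sided n \<sigma> \<longleftrightarrow> signing n \<sigma> \<and>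
     (\<exists>z. balanced_vector n z \<and>
        (sign_matrix n \<sigma> = outer n z (ones_vec n) \<or> sign_matrix n \<sigma> = outer n (ones_vec n) z))"

definition eps_close ::
  "real \<Rightarrow> nat \<Rightarrow> ((nat + nat) set \<Rightarrow> int) \<Rightarrow> ((nat + nat) set \<Rightarrow> int) \<Rightarrow> bool" where
  "eps_close \<epsilon> n \<sigma> \<sigma>' \<longleftrightarrow>
     real (card {(i, j). i < n \<and> j < n \<and> sign_matrix n \<sigma> $$ (i, j) \<noteq> sign_matrix n \<sigma>' $$ (i, j)})
       \<le> \<epsilon> * (real n)\<^sup>2"

end

theory Submission
  imports Defs "HOL-Combinatorics.Permutations" "HOL-Real_Asymp.Real_Asymp" "HOL-Number_Theory.Cong"
begin

text \<open>
  If the entries of the sign matrix have a sum of order \<open>n\<^sup>2\<close>, then a cyclic Latin square with randomly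
  permuted columns works: the exponential moments of a permutation sum are subgaussian, so all \<open>n\<close>
  colour classes are simultaneously close to the mean.

  Otherwise consider the \<open>2 \<times> 2\<close> submatrices whose two diagonals have different sums. If they are rare,
  then up to few errors every row differs by a constant from a fixed row, which forces the
  signing to be close to a one-sided one, and the small total sum allows to balance it.

  If they have positive density, write \<open>n = 2 m + r\<close> with \<open>m\<close> odd and \<open>r < 4\<close>, pair up rows and columns,
  and permute the column pairs at random, such that every colour class of the cyclic square of
  order \<open>m\<close>, and every one of its transversals \<open>2 i + j = t\<close>, contains linearly many pairs of pairs
  with different diagonals. The doubled square can be prolonged along \<open>r\<close> transversals to a Latin
  square of order \<open>n\<close>. Exchanging the two diagonals of a block moves weight between the two colours
  using the block, while their total is fixed; with linearly many effective exchanges at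
  hand both sums can be moved away from zero.
\<close>

section \<open>Concentration of permutation sums\<close>

text \<open>For \<open>x < 0\<close> put \<open>y = - x\<close>: the product
  \<open>(1 - y + y^2) * (1 + y + y^2 / 2)\<close> expands to at least 1, and its second factor is
  at most \<open>exp y\<close>.\<close>

lemma exp_le_quadratic:
  fixes x :: real
  assumes "\<bar>x\<bar> \<le> 1"
  shows "exp x \<le> 1 + x + x\<^sup>2"
proof (cases "0 \<le> x")
  case True
  then show ?thesis using exp_bound[of x] assms by auto
next
  case False
  define y where "y = - x"
  have y: "0 \<le> y" using False y_def by auto
  have "1 \<le> 1 + y^2 / 2 + y^3 / 2 + y^4 / 2" using y by auto
  also have "\<dots> = (1 - y + y\<^sup>2) * (1 + y + y\<^sup>2 / 2)"
    by (simp add: field_simps power2_eq_square power3_eq_cube power4_eq_xxxx)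
  also have "\<dots> \<le> (1 - y + y\<^sup>2) * exp y"
  proof (rule mult_left_mono)
    show "1 + y + y\<^sup>2 / 2 \<le> exp y" using exp_lower_Taylor_quadratic[OF y] .
    show "0 \<le> 1 - y + y\<^sup>2" using y assms y_def by auto
  qed
  finally have "exp (- y) \<le> 1 - y + y\<^sup>2"
    by (simp add: exp_minus field_simps)
  then show ?thesis by (simp add: y_def)
qed

text \<open>Hoeffding-type bound: centred at the mean the linear terms cancel, and the oscillation
  \<open>d\<close> bounds each deviation from the mean, so only the quadratic term survives.\<close>

lemma sum_exp_le_card_mult_exp_mean:
  fixes f :: "'a \<Rightarrow> real"
  assumes "finite B" "B \<noteq> {}" "\<And>b b'. b \<in> B \<Longrightarrow> b' \<in> B \<Longrightarrow> \<bar>f b - f b'\<bar> \<le> d"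
    and "\<bar>l\<bar> * d \<le> 1"
  shows "(\<Sum>b\<in>B. exp (l * f b)) \<le> card B * exp (l * ((\<Sum>b\<in>B. f b) / card B) + (l * d)\<^sup>2)"
proof -
  define \<mu> where "\<mu> = (\<Sum>b\<in>B. f b) / card B"
  have c: "card B > 0" using assms by (simp add: card_gt_0_iff)
  have dev: "\<bar>f b - \<mu>\<bar> \<le> d" if "b \<in> B" for b
  proof -
    have "card B * (f b - \<mu>) = (\<Sum>b'\<in>B. f b - f b')"
      using c by (simp add: \<mu>_def sum_subtractf field_simps)
    then have "card B * \<bar>f b - \<mu>\<bar> = \<bar>\<Sum>b'\<in>B. f b - f b'\<bar>"
      by (metis abs_mult abs_of_nat)
    also have "\<dots> \<le> (\<Sum>b'\<in>B. d)" using assms(3) that by (intro order_trans[OF sum_abs] sum_mono) auto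
    finally show ?thesis using c by simp
  qed
  have "exp (l * f b) \<le> exp (l * \<mu>) * (1 + l * (f b - \<mu>) + (l * d)\<^sup>2)" if "b \<in> B" for b
  proof -
    have 1: "\<bar>l * (f b - \<mu>)\<bar> \<le> \<bar>l\<bar> * d" using dev[OF that] by (simp add: abs_mult mult_left_mono)
    then have "exp (l * (f b - \<mu>)) \<le> 1 + l * (f b - \<mu>) + (l * (f b - \<mu>))\<^sup>2"
      using assms(4) by (intro exp_le_quadratic) auto
    also have "(l * (f b - \<mu>))\<^sup>2 \<le> (l * d)\<^sup>2"
      using 1 by (intro abs_le_square_iff[THEN iffD1]) (simp add: abs_mult order_trans[OF _ mult_left_mono[OF abs_ge_self]])
    finally have "exp (l * \<mu>) * exp (l * (f b - \<mu>)) \<le> exp (l * \<mu>) * (1 + l * (f b - \<mu>) + (l * d)\<^sup>2)"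
      by (simp add: mult_left_mono)
    moreover have "l * f b = l * \<mu> + l * (f b - \<mu>)" by (simp add: algebra_simps)
    ultimately show ?thesis by (simp only: exp_add)
  qed
  then have "(\<Sum>b\<in>B. exp (l * f b)) \<le> (\<Sum>b\<in>B. exp (l * \<mu>) * (1 + l * (f b - \<mu>) + (l * d)\<^sup>2))"
    by (rule sum_mono)
  also have "\<dots> = exp (l * \<mu>) * (card B * (1 + (l * d)\<^sup>2) + l * (\<Sum>b\<in>B. f b - \<mu>))"
    by (simp only: sum_distrib_left[symmetric] sum.distrib sum_constant distrib_left)
  also have "(\<Sum>b\<in>B. f b - \<mu>) = 0" using c by (simp add: sum_subtractf \<mu>_def)
  also have "exp (l * \<mu>) * (card B * (1 + (l * d)\<^sup>2) + l * 0) \<le> exp (l * \<mu>) * (card B * exp ((l * d)\<^sup>2))"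
    by (auto intro!: mult_left_mono)
  finally show ?thesis by (simp add: \<mu>_def exp_add algebra_simps)
qed

text \<open>Martingale argument by induction: the image \<open>b\<close> of the new point
  \<open>a\<close> is fixed first. The conditional mean of the whole sum changes by at most 4 with
  \<open>b\<close>, so each point costs a factor \<open>exp ((4 * l)^2)\<close>. The induction
  hypothesis is used for \<open>w\<close> with columns \<open>a\<close> and \<open>b\<close>
  exchanged, hence the bound on \<open>w\<close> at all indices.\<close>

lemma sum_exp_permutes_le:
  fixes w :: "'a \<Rightarrow> 'a \<Rightarrow> real"
  assumes "finite S" "\<And>i j. \<bar>w i j\<bar> \<le> 1" "\<bar>l\<bar> \<le> 1 / 4"
  shows "(\<Sum>p | p permutes S. exp (l * (\<Sum>i\<in>S. w i (p i))))
    \<le> fact (card S) * exp (l * ((\<Sum>i\<in>S. \<Sum>j\<in>S. w i j) / card S) + (4 * l)\<^sup>2 * card S)"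
  using assms(1,2)
proof (induction S arbitrary: w rule: finite_induct)
  case empty
  then show ?case by simp
next
  case (insert a S)
  let ?S' = "insert a S"
  let ?N = "card S"
  \<comment> \<open>Conditional mean of the sum over \<open>S\<close> given \<open>p a = b\<close>,
    the other values being \<open>transpose a b (q i)\<close> for a permutation \<open>q\<close> of
    \<open>S\<close>. For empty \<open>S\<close> division by zero makes it 0.\<close>
  define \<mu> where "\<mu> b = (\<Sum>i\<in>S. \<Sum>j\<in>S. w i (transpose a b j)) / ?N" for b
  define f where "f b = w a b + \<mu> b" for b
  have row: "(\<Sum>j\<in>S. w i (transpose a b j)) = (\<Sum>j\<in>?S'. w i j) - w i b" if "b \<in> ?S'" for i b
  proof -
    have "(\<Sum>j\<in>?S'. w i j) = (\<Sum>j\<in>?S'. w i (transpose a b j))"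
      using that by (intro sum.permute[of "transpose a b" ?S', unfolded comp_def] permutes_swap_id) auto
    then show ?thesis using insert.hyps by simp
  qed
  have mu: "\<mu> b = (\<Sum>i\<in>S. (\<Sum>j\<in>?S'. w i j) - w i b) / ?N" if "b \<in> ?S'" for b
    using row[OF that] by (simp add: \<mu>_def)
  \<comment> \<open>The term of \<open>a\<close> and the conditional mean of the rest each vary by
    at most 2.\<close>
  have diff: "\<bar>f b - f b'\<bar> \<le> 4" if "b \<in> ?S'" "b' \<in> ?S'" for b b'
  proof -
    have "\<mu> b - \<mu> b' = (\<Sum>i\<in>S. w i b' - w i b) / ?N"
      using that by (simp add: mu diff_divide_distrib[symmetric] sum_subtractf)
    moreover have "\<bar>\<Sum>i\<in>S. w i b' - w i b\<bar> \<le> (\<Sum>i\<in>S. 2)"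
    proof (rule order_trans[OF sum_abs], rule sum_mono)
      fix i show "\<bar>w i b' - w i b\<bar> \<le> 2" using insert.prems[of i b] insert.prems[of i b'] by linarith
    qed
    ultimately have "\<bar>\<mu> b - \<mu> b'\<bar> \<le> 2"
      by (simp add: divide_le_eq abs_div split: if_splits)
    then show ?thesis using insert.prems[of a b] insert.prems[of a b'] unfolding f_def by linarith
  qed
  \<comment> \<open>Averaging over \<open>b\<close> recovers the total: an entry
    \<open>w i j\<close> with \<open>i\<close> in \<open>S\<close> is left out for exactly one of
    the \<open>card S + 1\<close> choices of \<open>b\<close>.\<close>
  have mean: "(\<Sum>b\<in>?S'. f b) = (\<Sum>i\<in>?S'. \<Sum>j\<in>?S'. w i j)"
  proof (cases "S = {}")
    case True
    then show ?thesis by (simp add: f_def \<mu>_def)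
  next
    case False
    then have N: "?N > 0" using insert.hyps by (simp add: card_gt_0_iff)
    have "(\<Sum>b\<in>?S'. \<mu> b) = (\<Sum>b\<in>?S'. \<Sum>i\<in>S. (\<Sum>j\<in>?S'. w i j) - w i b) / ?N"
      by (simp add: mu sum_divide_distrib del: sum.insert)
    also have "(\<Sum>b\<in>?S'. \<Sum>i\<in>S. (\<Sum>j\<in>?S'. w i j) - w i b)
      = (\<Sum>i\<in>S. \<Sum>b\<in>?S'. (\<Sum>j\<in>?S'. w i j) - w i b)" by (rule sum.swap)
    also have "\<dots> = ?N * (\<Sum>i\<in>S. \<Sum>j\<in>?S'. w i j)"
      using insert.hyps by (simp add: sum_subtractf sum_distrib_left algebra_simps)
    finally have "(\<Sum>b\<in>?S'. \<mu> b) = (\<Sum>i\<in>S. \<Sum>j\<in>?S'. w i j)" using N by simp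
    then show ?thesis using insert.hyps by (simp add: f_def sum.distrib)
  qed
  have "(\<Sum>p | p permutes ?S'. exp (l * (\<Sum>i\<in>?S'. w i (p i))))
    = (\<Sum>b\<in>?S'. \<Sum>q | q permutes S. exp (l * (\<Sum>i\<in>?S'. w i ((transpose a b \<circ> q) i))))"
    by (rule sum_over_permutations_insert[OF insert.hyps])
  also have "\<dots> = (\<Sum>b\<in>?S'. exp (l * w a b) * (\<Sum>q | q permutes S. exp (l * (\<Sum>i\<in>S. w i (transpose a b (q i))))))"
  proof -
    have "exp (l * (\<Sum>i\<in>?S'. w i ((transpose a b \<circ> q) i)))
      = exp (l * w a b) * exp (l * (\<Sum>i\<in>S. w i (transpose a b (q i))))" if "q permutes S" for q b
      using insert.hyps permutes_not_in[OF that, of a] by (simp add: exp_add distrib_left)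
    then show ?thesis by (simp add: sum_distrib_left)
  qed
  also have "\<dots> \<le> (\<Sum>b\<in>?S'. exp (l * w a b) * (fact ?N * exp (l * \<mu> b + (4 * l)\<^sup>2 * ?N)))"
    unfolding \<mu>_def
    by (intro sum_mono mult_left_mono insert.IH[where w = "\<lambda>i j. w i (transpose a b j)" for b]) (auto simp: insert.prems)
  also have "\<dots> = fact ?N * exp ((4 * l)\<^sup>2 * ?N) * (\<Sum>b\<in>?S'. exp (l * f b))"
    unfolding sum_distrib_left
    by (rule sum.cong) (simp_all add: f_def exp_add algebra_simps)
  also have "\<dots> \<le> fact ?N * exp ((4 * l)\<^sup>2 * ?N) *
      (card ?S' * exp (l * ((\<Sum>b\<in>?S'. f b) / card ?S') + (l * 4)\<^sup>2))"
    using insert.hyps diff assms(3)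
    by (intro mult_left_mono sum_exp_le_card_mult_exp_mean) auto
  also have "\<dots> = fact (card ?S') * exp (l * ((\<Sum>i\<in>?S'. \<Sum>j\<in>?S'. w i j) / card ?S') + (4 * l)\<^sup>2 * card ?S')"
    unfolding mean using insert.hyps by (simp add: exp_add algebra_simps del: sum.insert)
  finally show ?case .
qed

text \<open>Union bound for a random relabelling of the columns.\<close>

lemma ex_permutes_all_sums_ge:
  fixes w :: "nat \<Rightarrow> nat \<Rightarrow> real"
  assumes w: "\<And>i j. \<bar>w i j\<bar> \<le> 1" and s: "0 < s" "s \<le> 1"
    and P: "finite P" "P \<subseteq> {p. p permutes {..<m}}"
    and small: "card P * exp (- (s\<^sup>2 * m / 64)) < 1"
  shows "\<exists>\<rho>. \<rho> permutes {..<m} \<and>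
    (\<forall>p\<in>P. (\<Sum>i<m. w i (\<rho> (p i))) \<ge> (\<Sum>i<m. \<Sum>j<m. w i j) / m - s * m)"
proof (rule ccontr)
  assume neg: "\<not> ?thesis"
  define W where "W = (\<Sum>i<m. \<Sum>j<m. w i j) / m"
  \<comment> \<open>The minimiser of \<open>l * s + 16 * l^2\<close>, with minimum
    \<open>- s^2 / 64\<close>; it is negative because lower tails are to be bounded.\<close>
  define l where "l = - s / 32"
  let ?R = "{\<rho>. \<rho> permutes {..<m}}"
  let ?h = "\<lambda>\<rho>. exp (l * (\<Sum>i<m. w i (\<rho> i)))"
  have finR: "finite ?R" by (simp add: finite_permutations)
  have cardR: "card ?R = fact m" by (rule card_permutations) auto
  have big: "exp (l * (W - s * m)) \<le> (\<Sum>p\<in>P. ?h (\<rho> \<circ> p))" if "\<rho> \<in> ?R" for \<rho>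
  proof -
    obtain p where p: "p \<in> P" "(\<Sum>i<m. w i (\<rho> (p i))) < W - s * m"
      using neg \<open>\<rho> \<in> ?R\<close> unfolding W_def by (metis mem_Collect_eq not_le)
    have "exp (l * (W - s * m)) \<le> ?h (\<rho> \<circ> p)"
      using p s by (simp add: l_def mult_left_mono)
    also have "\<dots> \<le> (\<Sum>p\<in>P. ?h (\<rho> \<circ> p))"
      by (rule member_le_sum[OF p(1)]) (use P in auto)
    finally show ?thesis .
  qed
  have "fact m * exp (l * (W - s * m)) = (\<Sum>\<rho>\<in>?R. exp (l * (W - s * m)))"
    using cardR by simp
  also have "\<dots> \<le> (\<Sum>\<rho>\<in>?R. \<Sum>p\<in>P. ?h (\<rho> \<circ> p))" using big by (rule sum_mono)
  also have "\<dots> = (\<Sum>p\<in>P. \<Sum>\<rho>\<in>?R. ?h (\<rho> \<circ> p))" by (rule sum.swap)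
  \<comment> \<open>For fixed \<open>p\<close>, \<open>\<rho> \<circ> p\<close> runs through all
    permutations as \<open>\<rho>\<close> does, so every \<open>p\<close> has the same exponential
    moment.\<close>
  also have "\<dots> = (\<Sum>p\<in>P. \<Sum>\<rho>\<in>?R. ?h \<rho>)"
    using P by (intro sum.cong refl sum_permutations_compose_right[symmetric]) auto
  also have "\<dots> \<le> (\<Sum>p\<in>P. fact m * exp (l * W + (4 * l)\<^sup>2 * m))"
    using sum_exp_permutes_le[of "{..<m}" w l] w s
    by (intro sum_mono) (auto simp: W_def l_def)
  also have "\<dots> = fact m * (card P * exp (l * W + (4 * l)\<^sup>2 * m))" by simp
  finally have "exp (l * (W - s * m)) \<le> card P * exp (l * W + (4 * l)\<^sup>2 * m)"
    by simp
  then have "1 \<le> card P * exp (l * W + (4 * l)\<^sup>2 * m - l * (W - s * m))"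
    by (simp add: exp_diff)
  also have "l * W + (4 * l)\<^sup>2 * m - l * (W - s * m) = - (s\<^sup>2 * m / 64)"
    by (simp add: l_def power2_eq_square field_simps)
  finally show False using small by simp
qed

section \<open>Latin squares and 1-factorizations\<close>

text \<open>Rows, columns and symbols share one index set. If it is finite, injectivity along lines
  already makes each symbol occur in every line.\<close>

definition latin :: "'a set \<Rightarrow> ('a \<Rightarrow> 'a \<Rightarrow> 'a) \<Rightarrow> bool" where
  "latin S L \<longleftrightarrow> (\<forall>x\<in>S. \<forall>y\<in>S. L x y \<in> S) \<and>
    (\<forall>x\<in>S. inj_on (L x) S) \<and> (\<forall>y\<in>S. inj_on (\<lambda>x. L x y) S)"

lemma latin_closed: "latin S L \<Longrightarrow> x \<in> S \<Longrightarrow> y \<in> S \<Longrightarrow> L x y \<in> S"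
  and latin_inj_row: "latin S L \<Longrightarrow> x \<in> S \<Longrightarrow> y \<in> S \<Longrightarrow> y' \<in> S \<Longrightarrow> L x y = L x y' \<Longrightarrow> y = y'"
  and latin_inj_column: "latin S L \<Longrightarrow> x \<in> S \<Longrightarrow> x' \<in> S \<Longrightarrow> y \<in> S \<Longrightarrow> L x y = L x' y \<Longrightarrow> x = x'"
  unfolding latin_def inj_on_def by blast+

lemma latin_ex1_column:
  assumes "finite S" "latin S L" "x \<in> S" "c \<in> S"
  shows "\<exists>!y. y \<in> S \<and> L x y = c"
proof -
  have inj: "inj_on (L x) S" and sub: "L x ` S \<subseteq> S" using assms by (auto simp: latin_def)
  then have "L x ` S = S" using assms(1) by (simp add: endo_inj_surj)
  then obtain y where "y \<in> S" "L x y = c" using assms(4) by (metis imageE)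
  then show ?thesis using inj by (auto simp: inj_on_def)
qed

lemma latin_ex1_row:
  assumes "finite S" "latin S L" "y \<in> S" "c \<in> S"
  shows "\<exists>!x. x \<in> S \<and> L x y = c"
proof -
  have inj: "inj_on (\<lambda>x. L x y) S" and sub: "(\<lambda>x. L x y) ` S \<subseteq> S"
    using assms by (auto simp: latin_def)
  then have "(\<lambda>x. L x y) ` S = S" using assms(1) by (simp add: endo_inj_surj)
  then obtain x where "x \<in> S" "L x y = c" using assms(4) by (smt (verit) imageE)
  then show ?thesis using inj by (auto simp: inj_on_def)
qed

text \<open>Writes a colour class as the graph of a permutation, the form to which the concentration
  bound applies; \<open>p\<close> is the identity off \<open>S\<close>, as \<open>permutes\<close>
  demands.\<close>

lemma latin_color_class_permutes:
  assumes "finite S" "latin S L" "c \<in> S"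
  shows "\<exists>p. p permutes S \<and> (\<forall>x\<in>S. \<forall>y\<in>S. L x y = c \<longleftrightarrow> y = p x)"
proof -
  define p where "p x = (if x \<in> S then THE y. y \<in> S \<and> L x y = c else x)" for x
  have p: "p x \<in> S \<and> L x (p x) = c" if "x \<in> S" for x
    using theI'[OF latin_ex1_column[OF assms(1,2) that assms(3)]] that by (simp add: p_def)
  have "inj_on p S"
  proof (rule inj_onI)
    fix x x' assume x: "x \<in> S" "x' \<in> S" "p x = p x'"
    then show "x = x'" using p[of x] p[of x'] latin_ex1_row[OF assms(1,2) _ assms(3), of "p x"] by auto
  qed
  moreover have "p ` S \<subseteq> S" using p by auto
  ultimately have "bij_betw p S S" using assms(1) by (simp add: bij_betw_def endo_inj_surj)
  then have "p permutes S" by (rule bij_imp_permutes) (simp add: p_def)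
  moreover have "L x y = c \<longleftrightarrow> y = p x" if "x \<in> S" "y \<in> S" for x y
    using p[OF that(1)] latin_ex1_column[OF assms(1,2) that(1) assms(3)] that(2) by auto
  ultimately show ?thesis by blast
qed

text \<open>Colour classes become perfect matchings because a symbol occurs once in each row and
  column. The bijections \<open>f\<close> and \<open>g\<close> say which vertices the rows and
  columns stand for, so that relabelling leaves the square itself unchanged. Each class has
  \<open>n\<close> edges, whence the factor \<open>n\<close> in the last hypothesis.\<close>

lemma one_factorization_of_latin:
  fixes f g :: "'a \<Rightarrow> nat" and d :: real
  assumes S: "finite S" and L: "latin S L"
    and f: "bij_betw f S {..<n}" and g: "bij_betw g S {..<n}"
    and q: "\<And>c. c \<in> S \<Longrightarrow>
      \<bar>\<Sum>(x, y) | x \<in> S \<and> y \<in> S \<and> L x y = c. \<sigma> {Inl (f x), Inr (g y)}\<bar> \<ge> q"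
    and d: "real_of_int q \<ge> d * n"
  shows "\<exists>F. one_factorization (Knn_verts n) (Knn_edges n) F \<and> (\<forall>M\<in>F. discrepancy \<sigma> M \<ge> d)"
proof -
  define e where "e = (\<lambda>(x, y). {Inl (f x), Inr (g y)} :: (nat + nat) set)"
  define C where "C c = {(x, y). x \<in> S \<and> y \<in> S \<and> L x y = c}" for c
  let ?F = "(\<lambda>c. e ` C c) ` S"
  have fS: "f ` S = {..<n}" "g ` S = {..<n}" and fi: "inj_on f S" "inj_on g S"
    using f g by (auto simp: bij_betw_def)
  have einj: "inj_on e (S \<times> S)"
    using fi by (auto simp: e_def inj_on_def doubleton_eq_iff)
  have CS: "C c \<subseteq> S \<times> S" for c by (auto simp: C_def)
  have cardC: "card (C c) = n" if c: "c \<in> S" for c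
  proof -
    have "bij_betw fst (C c) S"
    proof (rule bij_betw_imageI)
      show "inj_on fst (C c)"
        using L by (auto simp: C_def inj_on_def latin_def)
      show "fst ` C c = S"
      proof
        show "S \<subseteq> fst ` C c"
        proof
          fix x assume x: "x \<in> S"
          then obtain y where "y \<in> S" "L x y = c" using latin_ex1_column[OF S L _ c] by blast
          then have "(x, y) \<in> C c" using x by (simp add: C_def)
          then show "x \<in> fst ` C c" by force
        qed
      qed (auto simp: C_def)
    qed
    then show ?thesis using bij_betw_same_card[OF f] by (simp add: bij_betw_same_card)
  qed
  have union: "\<Union> ?F = Knn_edges n"
  proof
    show "\<Union> ?F \<subseteq> Knn_edges n"
    proof
      fix E assume "E \<in> \<Union> ?F"
      then obtain x y where xy: "x \<in> S" "y \<in> S" "E = {Inl (f x), Inr (g y)}"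
        by (auto simp: e_def C_def)
      then have "f x < n" "g y < n" using fS by auto
      then show "E \<in> Knn_edges n" using xy(3) unfolding Knn_edges_def by blast
    qed
    show "Knn_edges n \<subseteq> \<Union> ?F"
    proof
      fix E assume "E \<in> Knn_edges n"
      then obtain i j where ij: "i < n" "j < n" "E = {Inl i, Inr j}" by (auto simp: Knn_edges_def)
      then obtain x y where xy: "x \<in> S" "y \<in> S" "f x = i" "g y = j"
        using fS by (metis imageE lessThan_iff)
      then have "E = e (x, y)" "(x, y) \<in> C (L x y)" using ij(3) by (auto simp: e_def C_def)
      moreover have "L x y \<in> S" using L xy by (auto simp: latin_def)
      ultimately show "E \<in> \<Union> ?F" by blast
    qed
  qed
  have disj: "disjoint ?F"
  proof (rule disjointI)
    fix A B assume AB: "A \<in> ?F" "B \<in> ?F" "A \<noteq> B"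
    then obtain c c' where c: "A = e ` C c" "B = e ` C c'" by auto
    then have "C c \<inter> C c' = {}" using AB(3) by (auto simp: C_def)
    then have "e ` C c \<inter> e ` C c' = {}"
      using inj_on_image_Int[OF einj CS CS, of c c'] by simp
    then show "A \<inter> B = {}" using c by simp
  qed
  have pm: "perfect_matching (Knn_verts n) (Knn_edges n) (e ` C c)" if c: "c \<in> S" for c
    unfolding perfect_matching_def
  proof (intro conjI ballI)
    show "e ` C c \<subseteq> Knn_edges n" using union c by blast
    fix v assume "v \<in> Knn_verts n"
    then consider (row) i where "v = Inl i" "i < n" | (col) j where "v = Inr j" "j < n"
      by (auto simp: Knn_verts_def)
    then show "\<exists>!E. E \<in> e ` C c \<and> v \<in> E"
    proof cases
      case row
      then obtain x where x: "x \<in> S" "f x = i" using fS by (metis imageE lessThan_iff)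
      obtain y where y: "y \<in> S" "L x y = c" using latin_ex1_column[OF S L x(1) c] by blast
      show ?thesis
      proof (rule ex1I[of _ "e (x, y)"])
        show "e (x, y) \<in> e ` C c \<and> v \<in> e (x, y)" using x y row by (auto simp: e_def C_def)
        fix E assume "E \<in> e ` C c \<and> v \<in> E"
        then obtain x' y' where E: "E = e (x', y')" "x' \<in> S" "y' \<in> S" "L x' y' = c" "f x' = i"
          using row by (auto simp: C_def e_def)
        then have "x' = x" using fi x by (auto simp: inj_on_def)
        then have "y' = y" using E(3,4) y latin_ex1_column[OF S L x(1) c] by blast
        then show "E = e (x, y)" using E \<open>x' = x\<close> by simp
      qed
    next
      case col
      then obtain y where y: "y \<in> S" "g y = j" using fS by (metis imageE lessThan_iff)
      obtain x where x: "x \<in> S" "L x y = c" using latin_ex1_row[OF S L y(1) c] by blast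
      show ?thesis
      proof (rule ex1I[of _ "e (x, y)"])
        show "e (x, y) \<in> e ` C c \<and> v \<in> e (x, y)" using x y col by (auto simp: e_def C_def)
        fix E assume "E \<in> e ` C c \<and> v \<in> E"
        then obtain x' y' where E: "E = e (x', y')" "x' \<in> S" "y' \<in> S" "L x' y' = c" "g y' = j"
          using col by (auto simp: C_def e_def)
        then have "y' = y" using fi y by (auto simp: inj_on_def)
        then have "x' = x" using E(2,4) x latin_ex1_row[OF S L y(1) c] by blast
        then show "E = e (x, y)" using E \<open>y' = y\<close> by simp
      qed
    qed
  qed
  have disc: "discrepancy \<sigma> (e ` C c) \<ge> d" if c: "c \<in> S" for c
  proof -
    have inj: "inj_on e (C c)" using einj CS by (rule inj_on_subset)
    have n: "n > 0" using c cardC[OF c] fS by fastforce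
    have "signed_sum \<sigma> (e ` C c) = (\<Sum>(x, y)\<in>C c. \<sigma> {Inl (f x), Inr (g y)})"
      unfolding signed_sum_def by (subst sum.reindex[OF inj]) (auto simp: e_def intro: sum.cong)
    then have "\<bar>signed_sum \<sigma> (e ` C c)\<bar> \<ge> q" using q[OF c] by (simp add: C_def)
    then have "d * n \<le> real_of_int \<bar>signed_sum \<sigma> (e ` C c)\<bar>" using d by linarith
    then show ?thesis using n by (simp add: discrepancy_def card_image[OF inj] cardC[OF c] le_divide_eq)
  qed
  have ne: "{} \<notin> ?F"
  proof
    assume "{} \<in> ?F"
    then obtain c where c: "c \<in> S" "C c = {}" by auto
    then have "n = 0" using cardC[OF c(1)] by simp
    then show False using fS c by auto
  qed
  have "one_factorization (Knn_verts n) (Knn_edges n) ?F"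
    unfolding one_factorization_def partition_on_def using union disj ne pm by blast
  then show ?thesis using disc by blast
qed

lemma latin_add_mod:
  fixes m :: nat
  shows "latin {..<m} (\<lambda>i j. (i + j) mod m)"
proof -
  have *: "a = b" if "(x + a) mod m = (x + b) mod m" "a < m" "b < m" for a b x
    using that cong_add_lcancel_nat[of x a b m] by (simp add: cong_def)
  then have "inj_on (\<lambda>j. (i + j) mod m) {..<m}" for i by (auto intro!: inj_onI)
  moreover from this have "inj_on (\<lambda>i. (i + j) mod m) {..<m}" for j by (simp add: add.commute[of _ j])
  ultimately show ?thesis unfolding latin_def by simp
qed

section \<open>Submatrices with different diagonal sums\<close>

text \<open>Two transpositions: the first sends \<open>x\<close> to \<open>x'\<close>, the second
  corrects the image of \<open>y\<close> and fixes \<open>x'\<close>.\<close>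

lemma ex_permutes_two_points:
  assumes "x \<in> S" "y \<in> S" "x \<noteq> y" "x' \<in> S" "y' \<in> S" "x' \<noteq> y'"
  shows "\<exists>q. q permutes S \<and> q x = x' \<and> q y = y'"
proof -
  define t where "t = transpose x x'"
  define u where "u = transpose (t y) y'"
  have t: "t permutes S" unfolding t_def using assms by (intro permutes_swap_id)
  then have "t y \<in> S" using assms by (simp add: permutes_in_image)
  then have "u permutes S" unfolding u_def using assms by (intro permutes_swap_id)
  then have "(u \<circ> t) permutes S" using t by (intro permutes_compose)
  moreover have "t x = x'" by (simp add: t_def)
  moreover have "t y \<noteq> x'" using assms by (auto simp: t_def transpose_def)
  then have "u x' = x'" using assms by (auto simp: u_def transpose_def)
  moreover have "u (t y) = y'" by (simp add: u_def)
  ultimately show ?thesis by (intro exI[of _ "u \<circ> t"]) auto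
qed

text \<open>Double transitivity makes the sum over permutations the same for every ordered pair of
  distinct points; adding it up over all pairs and interchanging the summations gives the identity.
  The diagonal contributes nothing, as \<open>W u u = 0\<close>.\<close>

lemma sum_permutes_two_points:
  fixes W :: "'a \<Rightarrow> 'a \<Rightarrow> real"
  assumes S: "finite S" and xy: "x \<in> S" "y \<in> S" "x \<noteq> y" and W: "\<And>u. W u u = 0"
  shows "card S * (card S - 1) * (\<Sum>p | p permutes S. W (p x) (p y))
    = fact (card S) * (\<Sum>u\<in>S. \<Sum>v\<in>S. W u v)"
proof -
  define A where "A = (\<Sum>p | p permutes S. W (p x) (p y))"
  have const: "(\<Sum>p | p permutes S. W (p u) (p v)) = (if u = v then 0 else A)"
    if uv: "u \<in> S" "v \<in> S" for u v
  proof (cases "u = v")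
    case False
    then obtain q where q: "q permutes S" "q x = u" "q y = v"
      using ex_permutes_two_points[OF xy uv False] by blast
    show ?thesis
      using sum_permutations_compose_right[OF q(1), of "\<lambda>p. W (p x) (p y)"] q(2,3) False
      by (simp add: A_def)
  qed (simp add: W)
  have inv: "(\<Sum>u\<in>S. \<Sum>v\<in>S. W (p u) (p v)) = (\<Sum>u\<in>S. \<Sum>v\<in>S. W u v)" if p: "p permutes S" for p
    using sum.permute[OF p, of "\<lambda>u. \<Sum>v\<in>S. W u v"] sum.permute[OF p, of "W u" for u]
    by (simp add: comp_def)
  have "(\<Sum>u\<in>S. \<Sum>v\<in>S. \<Sum>p | p permutes S. W (p u) (p v))
      = (\<Sum>u\<in>S. \<Sum>v\<in>S. if u = v then 0 else A)" using const by simp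
  also have "\<dots> = (\<Sum>u\<in>S. (\<Sum>v\<in>S. A) - (\<Sum>v\<in>S. if v = u then A else 0))"
    unfolding sum_subtractf[symmetric] by (intro sum.cong) auto
  also have "\<dots> = card S * (card S - 1) * A"
    using S xy by (simp add: of_nat_diff algebra_simps Suc_le_eq card_gt_0_iff)
  finally have 1: "(\<Sum>u\<in>S. \<Sum>v\<in>S. \<Sum>p | p permutes S. W (p u) (p v)) = card S * (card S - 1) * A" .
  have "(\<Sum>u\<in>S. \<Sum>v\<in>S. \<Sum>p | p permutes S. W (p u) (p v))
      = (\<Sum>p | p permutes S. \<Sum>u\<in>S. \<Sum>v\<in>S. W (p u) (p v))"
    by (subst sum.swap[of _ S "{p. p permutes S}", symmetric]) (simp add: sum.swap[of _ S "{p. p permutes S}"])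
  also have "\<dots> = (\<Sum>p | p permutes S. \<Sum>u\<in>S. \<Sum>v\<in>S. W u v)" using inv by simp
  also have "\<dots> = fact (card S) * (\<Sum>u\<in>S. \<Sum>v\<in>S. W u v)"
    using card_permutations[OF refl S] by simp
  finally show ?thesis using 1 by (simp add: A_def)
qed

text \<open>First moment: under a random permutation the positions \<open>2 * a\<close> and
  \<open>2 * a + 1\<close> hold a uniform ordered pair of distinct points. Its mean weight is the
  total over \<open>n * (n - 1)\<close>, weakened to the total over \<open>n^2\<close>.\<close>

lemma ex_pairing_ge_average:
  fixes W :: "nat \<Rightarrow> nat \<Rightarrow> real" and m n :: nat
  assumes m: "2 * m \<le> n" and W: "\<And>u. W u u = 0" and nonneg: "\<And>u v. W u v \<ge> 0"
  shows "\<exists>p. p permutes {..<n} \<and>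
    (\<Sum>a<m. W (p (2 * a)) (p (2 * a + 1))) \<ge> m / (real n)\<^sup>2 * (\<Sum>u<n. \<Sum>v<n. W u v)"
proof (rule ccontr)
  assume neg: "\<not> ?thesis"
  define X where "X = (\<Sum>u<n. \<Sum>v<n. W u v)"
  let ?R = "{p. p permutes {..<n}}"
  have finR: "finite ?R" by (simp add: finite_permutations)
  have cardR: "card ?R = fact n" by (rule card_permutations) auto
  have X0: "X \<ge> 0" unfolding X_def using nonneg by (intro sum_nonneg) auto
  have "(\<Sum>p\<in>?R. \<Sum>a<m. W (p (2 * a)) (p (2 * a + 1))) < (\<Sum>p\<in>?R. m / (real n)\<^sup>2 * X)"
    using neg finR by (intro sum_strict_mono) (auto simp: X_def not_le intro: permutes_id)
  also have "\<dots> = fact n * (m / (real n)\<^sup>2 * X)" using cardR by simp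
  finally have lt: "(\<Sum>p\<in>?R. \<Sum>a<m. W (p (2 * a)) (p (2 * a + 1))) < fact n * (m / (real n)\<^sup>2 * X)" .
  have "(\<Sum>p\<in>?R. \<Sum>a<m. W (p (2 * a)) (p (2 * a + 1)))
      = (\<Sum>a<m. \<Sum>p\<in>?R. W (p (2 * a)) (p (2 * a + 1)))" by (rule sum.swap)
  also have "\<dots> \<ge> (\<Sum>a<m. fact n * X / (real n)\<^sup>2)"
  proof (rule sum_mono)
    fix a assume "a \<in> {..<m}"
    then have a: "2 * a + 1 < n" using m by simp
    let ?A = "\<Sum>p\<in>?R. W (p (2 * a)) (p (2 * a + 1))"
    have A0: "?A \<ge> 0" using nonneg by (intro sum_nonneg) auto
    have eq: "real (n * (n - 1)) * ?A = fact n * X"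
      using sum_permutes_two_points[of "{..<n}" "2 * a" "2 * a + 1" W] a W by (simp add: X_def)
    have "real (n * (n - 1)) \<le> (real n)\<^sup>2"
      by (simp add: power2_eq_square) (metis diff_le_self mult_le_mono2 of_nat_le_iff of_nat_mult)
    then have "fact n * X \<le> (real n)\<^sup>2 * ?A"
      unfolding eq[symmetric] using A0 by (rule mult_right_mono)
    then show "fact n * X / (real n)\<^sup>2 \<le> ?A" using a by (simp add: divide_le_eq mult.commute)
  qed
  finally show False using lt by (simp add: algebra_simps)
qed

text \<open>Equivalently, the difference of rows \<open>i\<close> and \<open>i'\<close> takes
  distinct values at \<open>j\<close> and \<open>j'\<close>. Degenerate quadruples with
  \<open>i = i'\<close> or \<open>j = j'\<close> never qualify, so counting may run over all
  quadruples.\<close>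

definition unbalanced :: "(nat \<Rightarrow> nat \<Rightarrow> int) \<Rightarrow> nat \<Rightarrow> nat \<Rightarrow> nat \<Rightarrow> nat \<Rightarrow> bool" where
  "unbalanced M i i' j j' \<longleftrightarrow> M i j + M i' j' \<noteq> M i j' + M i' j"

definition unbalanced_count :: "nat \<Rightarrow> (nat \<Rightarrow> nat \<Rightarrow> int) \<Rightarrow> real" where
  "unbalanced_count n M = (\<Sum>i<n. \<Sum>i'<n. \<Sum>j<n. \<Sum>j'<n. of_bool (unbalanced M i i' j j'))"


text \<open>Averaging over row pairings and then, for the rows already paired, over column pairings;
  each round contributes a factor \<open>m / n^2\<close>.\<close>

lemma ex_pairings_many_unbalanced:
  assumes m: "2 * m \<le> n" and n: "n > 0" and Q: "unbalanced_count n M \<ge> \<delta> * real n ^ 4"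
  shows "\<exists>p q. p permutes {..<n} \<and> q permutes {..<n} \<and>
    (\<Sum>a<m. \<Sum>b<m. of_bool (unbalanced M (p (2 * a)) (p (2 * a + 1)) (q (2 * b)) (q (2 * b + 1))))
      \<ge> \<delta> * (real m)\<^sup>2"
proof -
  let ?u = "\<lambda>i i' j j'. of_bool (unbalanced M i i' j j') :: real"
  obtain p where p: "p permutes {..<n}"
    "(\<Sum>a<m. \<Sum>j<n. \<Sum>j'<n. ?u (p (2 * a)) (p (2 * a + 1)) j j') \<ge> m / (real n)\<^sup>2 * unbalanced_count n M"
    using ex_pairing_ge_average[OF m, of "\<lambda>i i'. \<Sum>j<n. \<Sum>j'<n. ?u i i' j j'"]
    unfolding unbalanced_count_def by (auto simp: unbalanced_def sum_nonneg)
  obtain q where q: "q permutes {..<n}"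
    "(\<Sum>b<m. \<Sum>a<m. ?u (p (2 * a)) (p (2 * a + 1)) (q (2 * b)) (q (2 * b + 1)))
      \<ge> m / (real n)\<^sup>2 * (\<Sum>j<n. \<Sum>j'<n. \<Sum>a<m. ?u (p (2 * a)) (p (2 * a + 1)) j j')"
    using ex_pairing_ge_average[OF m, of "\<lambda>j j'. \<Sum>a<m. ?u (p (2 * a)) (p (2 * a + 1)) j j'"]
    by (auto simp: unbalanced_def sum_nonneg)
  have "(\<Sum>j<n. \<Sum>j'<n. \<Sum>a<m. ?u (p (2 * a)) (p (2 * a + 1)) j j')
    = (\<Sum>j<n. \<Sum>a<m. \<Sum>j'<n. ?u (p (2 * a)) (p (2 * a + 1)) j j')"
    by (intro sum.cong refl sum.swap)
  also have "\<dots> = (\<Sum>a<m. \<Sum>j<n. \<Sum>j'<n. ?u (p (2 * a)) (p (2 * a + 1)) j j')"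
    by (rule sum.swap)
  finally have sw: "(\<Sum>j<n. \<Sum>j'<n. \<Sum>a<m. ?u (p (2 * a)) (p (2 * a + 1)) j j') = \<dots>" .
  have "\<delta> * (real m)\<^sup>2 = m / (real n)\<^sup>2 * (m / (real n)\<^sup>2 * (\<delta> * real n ^ 4))"
    using n by (simp add: field_simps power2_eq_square power4_eq_xxxx)
  also have "\<dots> \<le> m / (real n)\<^sup>2 * (m / (real n)\<^sup>2 * unbalanced_count n M)"
    using Q by (intro mult_left_mono) auto
  also have "\<dots> \<le> m / (real n)\<^sup>2 * (\<Sum>a<m. \<Sum>j<n. \<Sum>j'<n. ?u (p (2 * a)) (p (2 * a + 1)) j j')"
    using p(2) by (intro mult_left_mono) auto
  also have "\<dots> \<le> (\<Sum>b<m. \<Sum>a<m. ?u (p (2 * a)) (p (2 * a + 1)) (q (2 * b)) (q (2 * b + 1)))"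
    using q(2) unfolding sw .
  also have "\<dots> = (\<Sum>a<m. \<Sum>b<m. ?u (p (2 * a)) (p (2 * a + 1)) (q (2 * b)) (q (2 * b + 1)))"
    by (rule sum.swap)
  finally show ?thesis using p(1) q(1) by blast
qed

section \<open>Signings with few such submatrices\<close>

text \<open>It suffices to negate half of the surplus of the majority sign; by symmetry the majority
  may be taken positive.\<close>

lemma ex_balanced_vector_near:
  assumes z: "\<And>i. i < n \<Longrightarrow> z i \<in> {-1, 1 :: int}"
  shows "\<exists>z'. balanced_vector n (vec n z') \<and> 2 * int (card {i. i < n \<and> z i \<noteq> z' i}) \<le> \<bar>\<Sum>i<n. z i\<bar>"
proof -
  have main: "\<exists>z'. balanced_vector n (vec n z') \<and> 2 * int (card {i. i < n \<and> z i \<noteq> z' i}) \<le> \<bar>\<Sum>i<n. z i\<bar>"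
    if z: "\<And>i. i < n \<Longrightarrow> z i \<in> {-1, 1 :: int}" and pos: "(\<Sum>i<n. z i) \<ge> 0" for z
  proof -
    define P where "P = {i. i < n \<and> z i = 1}"
    define N where "N = {i. i < n \<and> z i = -1}"
    have PN: "{..<n} = P \<union> N" "P \<inter> N = {}" using z by (auto simp: P_def N_def)
    have fin: "finite P" "finite N" by (auto simp: P_def N_def)
    have "(\<Sum>i<n. z i) = (\<Sum>i\<in>P. z i) + (\<Sum>i\<in>N. z i)"
      unfolding PN(1) using fin PN(2) by (rule sum.union_disjoint)
    also have "\<dots> = int (card P) - int (card N)" by (simp add: P_def N_def)
    finally have sum: "(\<Sum>i<n. z i) = int (card P) - int (card N)" .
    \<comment> \<open>Each negation lowers the difference by 2, so rounding down leaves a surplus of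
      0 or 1.\<close>
    define h where "h = (card P - card N) div 2"
    have "h \<le> card P" by (simp add: h_def)
    then obtain H where H: "H \<subseteq> P" "card H = h" "finite H" using obtain_subset_with_card_n by metis
    define z' where "z' i = (if i \<in> H then -1 else z i)" for i
    have "{i. i < n \<and> z' i = 1} = P - H" using H by (auto simp: z'_def P_def)
    then have c1: "card {i. i < n \<and> z' i = 1} = card P - h" using H by (simp add: card_Diff_subset)
    have "{i. i < n \<and> z' i = -1} = N \<union> H" using H by (auto simp: z'_def P_def N_def)
    then have c2: "card {i. i < n \<and> z' i = -1} = card N + h"
      using H PN fin by (metis card_Un_disjoint disjoint_iff subsetD)
    have sgn: "z' i \<in> {-1, 1}" if "i < n" for i using z[OF that] by (simp add: z'_def)
    have "{i. i < n \<and> vec n z' $ i = x} = {i. i < n \<and> z' i = x}" for x by auto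
    then have "balanced_vector n (vec n z')"
      unfolding balanced_vector_def sign_vector_def using sgn c1 c2 sum pos by (auto simp: h_def)
    moreover have "{i. i < n \<and> z i \<noteq> z' i} = H" using H by (auto simp: z'_def P_def)
    then have "2 * int (card {i. i < n \<and> z i \<noteq> z' i}) \<le> \<bar>\<Sum>i<n. z i\<bar>"
      using H sum pos by (simp add: h_def)
    ultimately show ?thesis by blast
  qed
  show ?thesis
  proof (cases "(\<Sum>i<n. z i) \<ge> 0")
    case True
    then show ?thesis using main z by blast
  next
    case False
    have "- z i \<in> {-1, 1}" if "i < n" for i using z[OF that] by auto
    moreover have "(\<Sum>i<n. - z i) \<ge> 0" using False by (simp add: sum_negf)
    ultimately obtain z' where z': "balanced_vector n (vec n z')"
      "2 * int (card {i. i < n \<and> - z i \<noteq> z' i}) \<le> \<bar>\<Sum>i<n. - z i\<bar>"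
      using main[of "\<lambda>i. - z i"] by blast
    have eq: "{i. i < n \<and> vec n (\<lambda>i. - z' i) $ i = x} = {i. i < n \<and> vec n z' $ i = - x}" for x by auto
    have sgn: "z' i = -1 \<or> z' i = 1" if "i < n" for i
      using z'(1) that unfolding balanced_vector_def sign_vector_def by auto
    have "sign_vector n (vec n (\<lambda>i. - z' i))"
      unfolding sign_vector_def using sgn by (metis (no_types, lifting) add.inverse_inverse index_vec insert_iff vec_carrier)
    then have "balanced_vector n (vec n (\<lambda>i. - z' i))"
      using z'(1) unfolding balanced_vector_def eq by (simp add: abs_minus_commute)
    moreover have "{i. i < n \<and> z i \<noteq> - z' i} = {i. i < n \<and> - z i \<noteq> z' i}" by auto
    ultimately show ?thesis using z'(2) by (intro exI[of _ "\<lambda>i. - z' i"]) (simp add: sum_negf)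
  qed
qed

definition mismatches :: "nat \<Rightarrow> (nat \<Rightarrow> nat \<Rightarrow> int) \<Rightarrow> (nat \<Rightarrow> nat \<Rightarrow> int) \<Rightarrow> real" where
  "mismatches n M M' = (\<Sum>i<n. \<Sum>j<n. of_bool (M i j \<noteq> M' i j))"

lemma mismatches_transpose: "mismatches n (\<lambda>i j. M j i) (\<lambda>i j. M' j i) = mismatches n M M'"
  unfolding mismatches_def by (rule sum.swap)

lemma ex_le_average:
  fixes f :: "nat \<Rightarrow> real"
  assumes "n > 0"
  shows "\<exists>i<n. n * f i \<le> (\<Sum>i<n. f i)"
proof (rule ccontr)
  assume "\<not> ?thesis"
  then have "(\<Sum>j<n. (\<Sum>i<n. f i)) < (\<Sum>j<n. n * f j)"
    using assms by (intro sum_strict_mono) (auto simp: not_le)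
  then show False by (simp add: sum_distrib_left)
qed

text \<open>Both the reference row \<open>i0\<close> and the offset \<open>t i\<close> of each other row are chosen by averaging.\<close>

lemma ex_reference_row:
  assumes n: "n > 0"
  shows "\<exists>i0<n. \<exists>t. (real n)\<^sup>2 * (\<Sum>i<n. \<Sum>j<n. of_bool (M i0 j - M i j \<noteq> t i)) \<le> unbalanced_count n M"
proof -
  obtain i0 where i0: "i0 < n"
    "n * (\<Sum>i<n. \<Sum>j<n. \<Sum>j'<n. of_bool (unbalanced M i0 i j j') :: real) \<le> unbalanced_count n M"
    unfolding unbalanced_count_def
    using ex_le_average[OF n, of "\<lambda>i0. \<Sum>i<n. \<Sum>j<n. \<Sum>j'<n. of_bool (unbalanced M i0 i j j')"] by blast
  have "\<exists>t. \<forall>i. n * (\<Sum>j<n. of_bool (M i0 j - M i j \<noteq> t i) :: real)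
      \<le> (\<Sum>j<n. \<Sum>j'<n. of_bool (unbalanced M i0 i j j'))"
  proof (rule choice, rule allI)
    fix i
    obtain j0 where "n * (\<Sum>j'<n. of_bool (unbalanced M i0 i j0 j') :: real)
      \<le> (\<Sum>j<n. \<Sum>j'<n. of_bool (unbalanced M i0 i j j'))"
      using ex_le_average[OF n, of "\<lambda>j. \<Sum>j'<n. of_bool (unbalanced M i0 i j j')"] by blast
    \<comment> \<open>Hence the columns counted at \<open>j0\<close> are exactly those violating the
      offset read off at \<open>j0\<close>.\<close>
    moreover have "unbalanced M i0 i j0 j' \<longleftrightarrow> M i0 j' - M i j' \<noteq> M i0 j0 - M i j0" for j'
      by (auto simp: unbalanced_def)
    ultimately show "\<exists>t. n * (\<Sum>j<n. of_bool (M i0 j - M i j \<noteq> t) :: real)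
        \<le> (\<Sum>j<n. \<Sum>j'<n. of_bool (unbalanced M i0 i j j'))"
      by (intro exI[of _ "M i0 j0 - M i j0"]) simp
  qed
  then obtain t where t: "\<And>i. n * (\<Sum>j<n. of_bool (M i0 j - M i j \<noteq> t i) :: real)
      \<le> (\<Sum>j<n. \<Sum>j'<n. of_bool (unbalanced M i0 i j j'))" by blast
  have "(real n)\<^sup>2 * (\<Sum>i<n. \<Sum>j<n. of_bool (M i0 j - M i j \<noteq> t i) :: real)
      = n * (\<Sum>i<n. n * (\<Sum>j<n. of_bool (M i0 j - M i j \<noteq> t i) :: real))"
    by (simp add: power2_eq_square sum_distrib_left mult.assoc)
  also have "\<dots> \<le> n * (\<Sum>i<n. \<Sum>j<n. \<Sum>j'<n. of_bool (unbalanced M i0 i j j') :: real)"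
    using t by (intro mult_left_mono sum_mono) auto
  finally show ?thesis using i0 by (intro exI[of _ i0] conjI exI[of _ t]) linarith+
qed

text \<open>Dichotomy for the reference row. If it is almost constant, each row is almost constant
  too, up to the errors \<open>X i\<close>. Otherwise both signs are common in it. A nonzero offset
  \<open>t i\<close> is compatible with at most one of them, so it forces \<open>X i\<close> to be
  at least \<open>\<tau> * n\<close>; by Markov's inequality such rows are rare, and the others
  nearly copy the reference row.\<close>

lemma near_one_sided_if_few_unbalanced:
  assumes n: "n > 0" and M: "\<And>i j. i < n \<Longrightarrow> j < n \<Longrightarrow> M i j \<in> {-1, 1}"
    and Q: "unbalanced_count n M \<le> \<delta> * real n ^ 4"
    and \<tau>: "0 < \<tau>" "\<tau> \<le> 1" and \<eta>: "\<delta> + \<tau> \<le> \<eta>" "\<delta> / \<tau> \<le> \<eta>"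
  shows "\<exists>z. (\<forall>i<n. z i \<in> {-1, 1}) \<and>
    (mismatches n M (\<lambda>i j. z i) \<le> \<eta> * (real n)\<^sup>2 \<or> mismatches n M (\<lambda>i j. z j) \<le> \<eta> * (real n)\<^sup>2)"
proof -
  obtain i0 t where i0: "i0 < n"
    and t: "(real n)\<^sup>2 * (\<Sum>i<n. \<Sum>j<n. of_bool (M i0 j - M i j \<noteq> t i)) \<le> unbalanced_count n M"
    using ex_reference_row[OF n, of M] by blast
  define X where "X i = (\<Sum>j<n. of_bool (M i0 j - M i j \<noteq> t i) :: real)" for i
  have X0: "X i \<ge> 0" for i unfolding X_def by (intro sum_nonneg) auto
  have "(real n)\<^sup>2 * (\<Sum>i<n. X i) \<le> (real n)\<^sup>2 * (\<delta> * (real n)\<^sup>2)"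
    using order_trans[OF t Q] by (simp add: X_def power2_eq_square power4_eq_xxxx algebra_simps)
  then have sumX: "(\<Sum>i<n. X i) \<le> \<delta> * (real n)\<^sup>2" using n by simp
  show ?thesis
  proof (cases "\<exists>s\<in>{-1, 1}. (\<Sum>j<n. of_bool (M i0 j \<noteq> s)) \<le> \<tau> * n")
    case True
    then obtain s where s: "s \<in> {-1, 1}" "(\<Sum>j<n. of_bool (M i0 j \<noteq> s)) \<le> \<tau> * n" by blast
    \<comment> \<open>Where the reference entry is \<open>s\<close> and the offset holds, row
      \<open>i\<close> has entry \<open>s - t i\<close>: this is \<open>- s\<close> for
      \<open>t i = 2 * s\<close> and \<open>s\<close> for \<open>t i = 0\<close>. Any other offset
      is violated at all such places.\<close>
    define z where "z i = (if t i = 2 * s then - s else s)" for i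
    have "mismatches n M (\<lambda>i j. z i) \<le> (\<Sum>i<n. X i + \<tau> * n)"
      unfolding mismatches_def
    proof (rule sum_mono)
      fix i assume i: "i \<in> {..<n}"
      have "(\<Sum>j<n. of_bool (M i j \<noteq> z i) :: real)
        \<le> (\<Sum>j<n. of_bool (M i0 j - M i j \<noteq> t i) + of_bool (M i0 j \<noteq> s))"
        using M[of i] M[OF i0] i s(1) by (intro sum_mono) (fastforce simp: z_def)
      also have "\<dots> = X i + (\<Sum>j<n. of_bool (M i0 j \<noteq> s))" by (simp add: X_def sum.distrib)
      finally show "(\<Sum>j<n. of_bool (M i j \<noteq> z i)) \<le> X i + \<tau> * n" using s(2) by simp
    qed
    also have "\<dots> = (\<Sum>i<n. X i) + \<tau> * (real n)\<^sup>2" by (simp add: sum.distrib power2_eq_square)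
    also have "\<dots> \<le> (\<delta> + \<tau>) * (real n)\<^sup>2" using sumX by (simp add: algebra_simps)
    also have "\<dots> \<le> \<eta> * (real n)\<^sup>2" using \<eta> by (intro mult_right_mono) auto
    finally have "mismatches n M (\<lambda>i j. z i) \<le> \<eta> * (real n)\<^sup>2" .
    moreover have "\<forall>i<n. z i \<in> {-1, 1}" using s by (auto simp: z_def)
    ultimately show ?thesis by blast
  next
    case False
    then have ns: "(\<Sum>j<n. of_bool (M i0 j \<noteq> s)) > \<tau> * n" if "s \<in> {-1, 1}" for s using that by force
    have "mismatches n M (\<lambda>i j. M i0 j) \<le> (\<Sum>i<n. X i / \<tau>)"
      unfolding mismatches_def
    proof (rule sum_mono)
      fix i assume i: "i \<in> {..<n}"
      show "(\<Sum>j<n. of_bool (M i j \<noteq> M i0 j)) \<le> X i / \<tau>"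
      proof (cases "t i = 0")
        case True
        then have "(\<Sum>j<n. of_bool (M i j \<noteq> M i0 j)) = X i"
          unfolding X_def by (intro sum.cong) auto
        also have "\<dots> \<le> X i / \<tau>" using \<tau> X0[of i] by (simp add: le_divide_eq mult_left_le)
        finally show ?thesis .
      next
        case False
        \<comment> \<open>A difference 2 needs \<open>M i0 j = 1\<close> and a difference
          \<open>-2\<close> needs \<open>M i0 j = -1\<close>; other nonzero offsets are violated
          everywhere, so \<open>-1\<close> serves as default.\<close>
        define s :: int where "s = (if t i = 2 then 1 else -1)"
        have "(\<Sum>j<n. of_bool (M i0 j \<noteq> s)) \<le> X i"
          unfolding X_def using M[of i] M[OF i0] i False by (intro sum_mono) (fastforce simp: s_def)
        moreover have "s \<in> {-1, 1}" by (simp add: s_def)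
        ultimately have "\<tau> * n \<le> X i" using ns[of s] by simp
        then have "n \<le> X i / \<tau>" using \<tau> by (simp add: le_divide_eq mult.commute)
        moreover have "(\<Sum>j<n. of_bool (M i j \<noteq> M i0 j)) \<le> (\<Sum>j<n. 1 :: real)" by (intro sum_mono) auto
        ultimately show ?thesis by simp
      qed
    qed
    also have "\<dots> \<le> (\<delta> * (real n)\<^sup>2) / \<tau>"
      unfolding sum_divide_distrib[symmetric] using sumX \<tau> by (intro divide_right_mono) auto
    also have "\<dots> \<le> \<eta> * (real n)\<^sup>2" using mult_right_mono[OF \<eta>(2), of "(real n)\<^sup>2"] by simp
    finally show ?thesis using M[OF i0] by (intro exI[of _ "M i0"]) blast
  qed
qed

text \<open>Since \<open>M\<close> has a small entry sum and its rows are nearly constant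
  \<open>z i\<close>, the sum of \<open>z\<close> times \<open>n\<close> is small, so few entries of
  \<open>z\<close> need changing. A mismatch shifts the entry sum by 2 and a changed entry of
  \<open>z\<close> affects \<open>n\<close> cells, which gives
  \<open>2 * \<eta> + \<mu> / 2\<close>.\<close>

lemma ex_balanced_near:
  assumes M: "\<And>i j. i < n \<Longrightarrow> j < n \<Longrightarrow> M i j \<in> {-1, 1}"
    and z: "\<And>i. i < n \<Longrightarrow> z i \<in> {-1, 1}"
    and near: "mismatches n M (\<lambda>i j. z i) \<le> \<eta> * (real n)\<^sup>2"
    and small: "real_of_int \<bar>\<Sum>i<n. \<Sum>j<n. M i j\<bar> \<le> \<mu> * (real n)\<^sup>2"
    and n: "n > 0"
  shows "\<exists>z'. balanced_vector n (vec n z') \<and> mismatches n M (\<lambda>i j. z' i) \<le> (2 * \<eta> + \<mu> / 2) * (real n)\<^sup>2"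
proof -
  obtain z' where z': "balanced_vector n (vec n z')"
    "2 * int (card {i. i < n \<and> z i \<noteq> z' i}) \<le> \<bar>\<Sum>i<n. z i\<bar>"
    using ex_balanced_vector_near[of n z] z by blast
  define D where "D = real (card {i. i < n \<and> z i \<noteq> z' i})"
  have D: "2 * D \<le> \<bar>\<Sum>i<n. real_of_int (z i)\<bar>"
  proof -
    have "real_of_int (2 * int (card {i. i < n \<and> z i \<noteq> z' i})) \<le> real_of_int \<bar>\<Sum>i<n. z i\<bar>"
      using z'(2) by (simp only: of_int_le_iff)
    then show ?thesis by (simp add: D_def)
  qed
  define T where "T = real_of_int (\<Sum>i<n. \<Sum>j<n. M i j)"
  define Z where "Z = (\<Sum>i<n. real_of_int (z i))"
  have T: "\<bar>T\<bar> \<le> \<mu> * (real n)\<^sup>2" using small by (simp add: T_def)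
  have "n * Z - T
      = (\<Sum>i<n. \<Sum>j<n. real_of_int (z i - M i j))"
    by (simp add: T_def Z_def sum_subtractf sum_distrib_left)
  also have "\<bar>\<dots>\<bar> \<le> (\<Sum>i<n. \<bar>\<Sum>j<n. real_of_int (z i - M i j)\<bar>)" by (rule sum_abs)
  also have "\<dots> \<le> (\<Sum>i<n. \<Sum>j<n. \<bar>real_of_int (z i - M i j)\<bar>)" by (intro sum_mono sum_abs)
  also have "\<dots> \<le> (\<Sum>i<n. \<Sum>j<n. 2 * of_bool (M i j \<noteq> z i))"
    using M z by (intro sum_mono) fastforce
  also have "\<dots> = 2 * mismatches n M (\<lambda>i j. z i)" unfolding mismatches_def sum_distrib_left ..
  finally have "\<bar>n * Z\<bar> \<le> 2 * (\<eta> * (real n)\<^sup>2) + \<mu> * (real n)\<^sup>2" using near T by linarith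
  then have "n * \<bar>Z\<bar> \<le> 2 * (\<eta> * (real n)\<^sup>2) + \<mu> * (real n)\<^sup>2" by (simp add: abs_mult)
  then have nD: "n * D \<le> (\<eta> + \<mu> / 2) * (real n)\<^sup>2"
    using mult_left_mono[OF D, of "real n"] unfolding Z_def by (simp add: algebra_simps)
  have "mismatches n M (\<lambda>i j. z' i) \<le> (\<Sum>i<n. \<Sum>j<n. of_bool (M i j \<noteq> z i) + of_bool (z i \<noteq> z' i))"
    unfolding mismatches_def by (intro sum_mono) auto
  also have "\<dots> = mismatches n M (\<lambda>i j. z i) + n * (\<Sum>i<n. of_bool (z i \<noteq> z' i) :: real)"
    by (simp add: mismatches_def sum.distrib sum_distrib_left)
  also have "(\<Sum>i<n. of_bool (z i \<noteq> z' i)) = D"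
    by (simp add: D_def Int_def)
  finally show ?thesis using near nD z'(1) by (intro exI[of _ z']) (simp add: algebra_simps)
qed

section \<open>Latin squares with exchangeable blocks\<close>

text \<open>Selects the larger of the two values on \<open>H\<close> and the smaller one elsewhere, so that the sums
  increase with \<open>H\<close>.\<close>

definition raise_flips :: "('a \<Rightarrow> bool \<Rightarrow> int) \<Rightarrow> 'a set \<Rightarrow> 'a \<Rightarrow> bool" where
  "raise_flips D H x \<longleftrightarrow> (D x False \<le> D x True \<longleftrightarrow> x \<in> H)"

text \<open>The values are integers, so every point of \<open>H - G\<close>, where the two values
  differ, gains at least 1.\<close>

lemma sum_raise_flips_mono:
  fixes D :: "'a \<Rightarrow> bool \<Rightarrow> int"
  assumes I: "finite I" and H: "H \<subseteq> {x \<in> I. D x True \<noteq> D x False}" and G: "G \<subseteq> H"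
  shows "(\<Sum>x\<in>I. D x (raise_flips D G x)) + card (H - G) \<le> (\<Sum>x\<in>I. D x (raise_flips D H x))"
proof -
  have "(\<Sum>x\<in>I. D x (raise_flips D G x) + of_bool (x \<in> H - G)) \<le> (\<Sum>x\<in>I. D x (raise_flips D H x))"
  proof (rule sum_mono)
    fix x assume "x \<in> I"
    show "D x (raise_flips D G x) + of_bool (x \<in> H - G) \<le> D x (raise_flips D H x)"
    proof (cases "x \<in> H - G")
      case True
      then have "D x True \<noteq> D x False" using H by auto
      then show ?thesis using True by (cases "D x False \<le> D x True") (auto simp: raise_flips_def)
    next
      case False
      then have "x \<in> H \<longleftrightarrow> x \<in> G" using G by auto
      then show ?thesis using False by (simp add: raise_flips_def)
    qed
  qed
  moreover have "I \<inter> {x. x \<in> H \<and> x \<notin> G} = H - G" using H by auto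
  ultimately show ?thesis using I by (simp add: sum.distrib)
qed

text \<open>The extreme choices give values at least \<open>2 * q\<close> apart, too far for both to
  lie strictly between \<open>- q\<close> and \<open>q\<close>.\<close>

lemma ex_flips_sum_ge:
  fixes D :: "'a \<Rightarrow> bool \<Rightarrow> int" and C q :: int
  assumes I: "finite I" and q: "2 * q \<le> card {x \<in> I. D x True \<noteq> D x False}"
  shows "\<exists>\<psi>. \<bar>C + (\<Sum>x\<in>I. D x (\<psi> x))\<bar> \<ge> q"
proof -
  let ?G = "{x \<in> I. D x True \<noteq> D x False}"
  define u where "u H = (\<Sum>x\<in>I. D x (raise_flips D H x))" for H
  have "u {} + 2 * q \<le> u ?G"
    using sum_raise_flips_mono[OF I, of ?G D "{}"] q by (simp add: u_def)
  then have "\<bar>C + u {}\<bar> \<ge> q \<or> \<bar>C + u ?G\<bar> \<ge> q" by linarith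
  then show ?thesis unfolding u_def by blast
qed

text \<open>Each of the two constraints excludes an interval of length less than \<open>2 q\<close>, hence at most
  one of three values with gaps at least \<open>2 q\<close>.\<close>

lemma ex_flips_both_sums_ge:
  fixes D :: "'a \<Rightarrow> bool \<Rightarrow> int" and C C' q :: int
  assumes I: "finite I" and q0: "0 \<le> q" and q: "4 * q \<le> card {x \<in> I. D x True \<noteq> D x False}"
  shows "\<exists>\<psi>. \<bar>C + (\<Sum>x\<in>I. D x (\<psi> x))\<bar> \<ge> q \<and> \<bar>C' + (\<Sum>x\<in>I. D x (\<not> \<psi> x))\<bar> \<ge> q"
proof -
  define G where "G = {x \<in> I. D x True \<noteq> D x False}"
  define u where "u H = (\<Sum>x\<in>I. D x (raise_flips D H x))" for H
  define tot where "tot = (\<Sum>x\<in>I. D x True + D x False)"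
  \<comment> \<open>The two sums have the fixed total \<open>tot\<close>, so one determines the
    other.\<close>
  have "D x (\<not> b) = D x True + D x False - D x b" for x b by (cases b) simp_all
  then have neg: "(\<Sum>x\<in>I. D x (\<not> \<psi> x)) = tot - (\<Sum>x\<in>I. D x (\<psi> x))" for \<psi>
    by (simp add: tot_def sum_subtractf)
  have fin: "finite G" using I by (simp add: G_def)
  \<comment> \<open>An intermediate set \<open>H\<close> is chosen so that \<open>{}\<close>,
    \<open>H\<close> and \<open>G\<close> give values with gaps of at least
    \<open>2 * q\<close>.\<close>
  have "nat (2 * q) \<le> card G" using q q0 unfolding G_def[symmetric] by linarith
  then obtain H where H: "H \<subseteq> G" "card H = nat (2 * q)" by (rule obtain_subset_with_card_n)
  have "u {} + 2 * q \<le> u H"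
    using sum_raise_flips_mono[OF I H(1)[unfolded G_def], of "{}"] H(2) q0 by (simp add: u_def)
  moreover have "card (G - H) = card G - nat (2 * q)"
    using H card_Diff_subset[OF finite_subset[OF H(1) fin] H(1)] by simp
  then have "u H + 2 * q \<le> u G"
    using sum_raise_flips_mono[OF I, of G D H] H q q0 by (simp add: u_def G_def)
  moreover have sep: "\<bar>x\<bar> \<ge> q \<or> \<bar>y\<bar> \<ge> q" if "x + 2 * q \<le> y" for x y :: int
    using that by linarith
  ultimately have "\<bar>C + u {}\<bar> \<ge> q \<or> \<bar>C + u H\<bar> \<ge> q" "\<bar>C + u H\<bar> \<ge> q \<or> \<bar>C + u G\<bar> \<ge> q"
    "\<bar>C + u {}\<bar> \<ge> q \<or> \<bar>C + u G\<bar> \<ge> q"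
    "\<bar>C' + (tot - u H)\<bar> \<ge> q \<or> \<bar>C' + (tot - u {})\<bar> \<ge> q"
    "\<bar>C' + (tot - u G)\<bar> \<ge> q \<or> \<bar>C' + (tot - u H)\<bar> \<ge> q"
    "\<bar>C' + (tot - u G)\<bar> \<ge> q \<or> \<bar>C' + (tot - u {})\<bar> \<ge> q"
    using q0 by (intro sep; linarith)+
  then have "(\<bar>C + u {}\<bar> \<ge> q \<and> \<bar>C' + (tot - u {})\<bar> \<ge> q) \<or> (\<bar>C + u H\<bar> \<ge> q \<and> \<bar>C' + (tot - u H)\<bar> \<ge> q)
    \<or> (\<bar>C + u G\<bar> \<ge> q \<and> \<bar>C' + (tot - u G)\<bar> \<ge> q)" by satx
  then obtain G' where "\<bar>C + u G'\<bar> \<ge> q" "\<bar>C' + (tot - u G')\<bar> \<ge> q" by (elim disjE conjE)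
  then have "\<bar>C + (\<Sum>x\<in>I. D x (raise_flips D G' x))\<bar> \<ge> q
    \<and> \<bar>C' + (\<Sum>x\<in>I. D x (\<not> raise_flips D G' x))\<bar> \<ge> q"
    unfolding neg[of "raise_flips D G'"] u_def by (rule conjI)
  then show ?thesis by (rule exI[of _ "raise_flips D G'"])
qed

section \<open>Prolonging a doubled Latin square along transversals\<close>

definition xor3 :: "bool \<Rightarrow> bool \<Rightarrow> bool \<Rightarrow> bool" where
  "xor3 a b c \<longleftrightarrow> ((a \<noteq> b) \<noteq> c)"

lemma xor3_inj:
  "xor3 a b c = xor3 a' b c \<longleftrightarrow> a = a'" "xor3 a b c = xor3 a b' c \<longleftrightarrow> b = b'"
  "xor3 a b c \<Longrightarrow> xor3 a b' c \<Longrightarrow> b = b'"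
  "\<not> xor3 a b c \<Longrightarrow> \<not> xor3 a b' c \<Longrightarrow> b = b'"
  "\<not> xor3 a b c \<Longrightarrow> \<not> xor3 a' b c \<Longrightarrow> a = a'"
  by (cases a; cases b; cases c; cases a'; cases b'; simp add: xor3_def)+

text \<open>\<open>T\<close> is an orthogonal mate of \<open>K\<close>, so each class
  \<open>T = t\<close> is a transversal of \<open>K\<close>. \<open>J i t\<close> is the column
  where it meets row \<open>i\<close>, and \<open>I j t\<close> the row where it meets column
  \<open>j\<close>; \<open>r\<close> is the number of lines to be added.\<close>

locale orthogonal_squares =
  fixes m r :: nat and K T I J :: "nat \<Rightarrow> nat \<Rightarrow> nat"
  assumes r: "r \<le> m"
    and K: "latin {..<m} K" and T: "latin {..<m} T"
    and orth: "\<And>i j i' j'. i < m \<Longrightarrow> j < m \<Longrightarrow> i' < m \<Longrightarrow> j' < m \<Longrightarrow>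
      K i j = K i' j' \<Longrightarrow> T i j = T i' j' \<Longrightarrow> i = i' \<and> j = j'"
    and J: "\<And>i t. i < m \<Longrightarrow> t < m \<Longrightarrow> J i t < m \<and> T i (J i t) = t"
    and I: "\<And>j t. j < m \<Longrightarrow> t < m \<Longrightarrow> I j t < m \<and> T (I j t) j = t"
begin

text \<open>The doubled square \<open>K \<times> \<int>\<^sub>2\<close>, whose \<open>2 \<times> 2\<close> blocks can be flipped independently by \<open>\<phi>\<close>,
  prolonged by \<open>r\<close> rows, columns and symbols: in the blocks on the transversals \<open>T = t\<close> with \<open>t < r\<close>
  one diagonal goes to the new symbol \<open>t\<close>, and the cell removed from row (column) \<open>x\<close> is made up
  for in the new column (row) \<open>t\<close>. The union of the two symbols \<open>(k, _)\<close> is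
  the same for all flips outside these transversals.\<close>

fun flip_square :: "(nat \<Rightarrow> nat \<Rightarrow> bool) \<Rightarrow> (nat \<times> bool) + nat \<Rightarrow> (nat \<times> bool) + nat \<Rightarrow> (nat \<times> bool) + nat" where
  "flip_square \<phi> (Inl (i, a)) (Inl (j, b)) =
    (if r \<le> T i j then Inl (K i j, xor3 a b (\<phi> i j))
     else if xor3 a b (\<phi> i j) then Inl (K i j, \<not> a) else Inr (T i j))"
| "flip_square \<phi> (Inl (i, a)) (Inr t) = Inl (K i (J i t), a)"
| "flip_square \<phi> (Inr t) (Inl (j, b)) = Inl (K (I j t) j, b = \<phi> (I j t) j)"
| "flip_square \<phi> (Inr t) (Inr u) = Inr ((t + u) mod r)"

definition S :: "((nat \<times> bool) + nat) set" where
  "S = ({..<m} \<times> UNIV) <+> {..<r}"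

lemma Inl_S [simp]: "Inl (i, a) \<in> S \<longleftrightarrow> i < m"
  and Inr_S [simp]: "Inr t \<in> S \<longleftrightarrow> t < r"
  by (auto simp: S_def)

lemma finite_S [simp]: "finite S"
  by (simp add: S_def)

lemma S_cases:
  assumes "x \<in> S"
  obtains (Inl) i a where "x = Inl (i, a)" "i < m" | (Inr) t where "x = Inr t" "t < r"
  using assms by (auto simp: S_def)

lemma K_less: "i < m \<Longrightarrow> j < m \<Longrightarrow> K i j < m"
  and K_row: "i < m \<Longrightarrow> j < m \<Longrightarrow> j' < m \<Longrightarrow> K i j = K i j' \<Longrightarrow> j = j'"
  and K_col: "i < m \<Longrightarrow> i' < m \<Longrightarrow> j < m \<Longrightarrow> K i j = K i' j \<Longrightarrow> i = i'"
  using latin_closed[OF K, of i j] latin_inj_row[OF K, of i j j'] latin_inj_column[OF K, of i i' j]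
  by (auto simp only: lessThan_iff)

lemma T_row: "i < m \<Longrightarrow> j < m \<Longrightarrow> j' < m \<Longrightarrow> T i j = T i j' \<Longrightarrow> j = j'"
  and T_col: "i < m \<Longrightarrow> i' < m \<Longrightarrow> j < m \<Longrightarrow> T i j = T i' j \<Longrightarrow> i = i'"
  using latin_inj_row[OF T, of i j j'] latin_inj_column[OF T, of i i' j]
  by (auto simp only: lessThan_iff)

lemma IJ:
  "i < m \<Longrightarrow> t < r \<Longrightarrow> J i t < m" "i < m \<Longrightarrow> t < r \<Longrightarrow> T i (J i t) = t"
  "j < m \<Longrightarrow> t < r \<Longrightarrow> I j t < m" "j < m \<Longrightarrow> t < r \<Longrightarrow> T (I j t) j = t"
  using J[OF _ less_le_trans[OF _ r], of i t] I[OF _ less_le_trans[OF _ r], of j t] by blast+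

lemma add_mod_cancel: "t < r \<Longrightarrow> u < r \<Longrightarrow> v < r \<Longrightarrow> (t + u) mod r = (t + v) mod r \<Longrightarrow> u = v"
  using latin_inj_row[OF latin_add_mod[of r], of t u v] by simp

text \<open>In row \<open>(i, a)\<close> of a block on a used transversal the surviving cell carries
  the bit \<open>\<not> a\<close>, so \<open>a\<close> goes to the new column; in column
  \<open>(j, b)\<close> it carries \<open>b \<noteq> \<phi> i j\<close>, so the opposite bit goes to
  the new row. The two surviving cells of a block carry different bits, so that the two symbols
  moved to the same new line differ as well. Orthogonality separates symbols coming from different
  blocks.\<close>

lemma latin_flip_square: "latin S (flip_square \<phi>)"
  unfolding latin_def
proof (intro conjI ballI inj_onI)
  fix x y assume x: "x \<in> S" and y: "y \<in> S"
  show "flip_square \<phi> x y \<in> S"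
    using x
  proof (cases rule: S_cases)
    case (Inl i a)
    from y show ?thesis
    proof (cases rule: S_cases)
      case l: (Inl j b)
      then show ?thesis using Inl K_less[of i j] by simp
    next
      case r: (Inr t)
      then show ?thesis using Inl K_less[of i "J i t"] IJ(1)[of i t] by simp
    qed
  next
    case (Inr t)
    show ?thesis using y by (cases rule: S_cases) (auto simp: Inr K_less IJ)
  qed
next
  fix x y y' assume x: "x \<in> S" and y: "y \<in> S" "y' \<in> S" and eq: "flip_square \<phi> x y = flip_square \<phi> x y'"
  from x show "y = y'"
  proof (cases rule: S_cases)
    case (Inl i a)
    \<comment> \<open>A block cell and a new cell of the same row could agree only in the block on
      transversal \<open>t\<close>, but there the surviving bit is \<open>\<not> a\<close>.\<close>
    have mixed: False if "j < m" "t < r" "flip_square \<phi> (Inl (i, a)) (Inl (j, b)) = Inl (K i (J i t), a)" for j b t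
    proof -
      have "K i j = K i (J i t)" using that by (simp split: if_splits)
      then have "j = J i t" by (rule K_row[OF Inl(2) that(1) IJ(1)[OF Inl(2) that(2)]])
      then have "T i j = t" using IJ(2)[OF Inl(2) that(2)] by simp
      then show False using that by (simp split: if_splits)
    qed
    from y(1) show ?thesis
    proof (cases rule: S_cases)
      case l: (Inl j b)
      from y(2) show ?thesis
      proof (cases rule: S_cases)
        case l': (Inl j' b')
        have "K i j = K i j' \<or> T i j = T i j'" using eq Inl l l' by (simp split: if_splits)
        then have "j = j'" using K_row T_row Inl l l' by blast
        then show ?thesis using eq Inl l l' by (simp add: xor3_inj split: if_splits)
      next
        case r': (Inr t')
        then show ?thesis using mixed[of j t' b] eq Inl l by simp
      qed
    next
      case r: (Inr t)
      from y(2) show ?thesis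
      proof (cases rule: S_cases)
        case l': (Inl j' b')
        then show ?thesis using mixed[of j' t b'] eq Inl r by simp
      next
        case r': (Inr t')
        then have "J i t = J i t'" using eq Inl r K_row[of i "J i t" "J i t'"] IJ by simp
        then have "t = t'" using IJ(2)[OF Inl(2) r(2)] IJ(2)[OF Inl(2) r'(2)] by metis
        then show ?thesis by (simp only: r(1) r'(1))
      qed
    qed
  next
    case (Inr t)
    from y(1) show ?thesis
    proof (cases rule: S_cases)
      case l: (Inl j b)
      from y(2) show ?thesis
      proof (cases rule: S_cases)
        case l': (Inl j' b')
        then have "K (I j t) j = K (I j' t) j'" using eq Inr l by simp
        \<comment> \<open>Both originating blocks lie on transversal \<open>t\<close> and have the
          same symbol of \<open>K\<close>.\<close>
        then have "j = j'" using orth[of "I j t" j "I j' t" j'] IJ Inr l l' by auto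
        then show ?thesis using eq Inr l l' by (cases b; cases b') auto
      qed (use eq Inr l in simp)
    next
      case r: (Inr u)
      from y(2) show ?thesis
      proof (cases rule: S_cases)
        case r': (Inr u')
        then show ?thesis using eq Inr r add_mod_cancel[of t u u'] by simp
      qed (use eq Inr r in simp)
    qed
  qed
next
  fix y x x' assume y: "y \<in> S" and x: "x \<in> S" "x' \<in> S" and eq: "flip_square \<phi> x y = flip_square \<phi> x' y"
  from y show "x = x'"
  proof (cases rule: S_cases)
    case (Inl j b)
    have mixed: False if "i < m" "t < r"
      "flip_square \<phi> (Inl (i, a)) (Inl (j, b)) = Inl (K (I j t) j, b = \<phi> (I j t) j)" for i a t
    proof -
      have "K i j = K (I j t) j" using that by (simp split: if_splits)
      then have "i = I j t" by (rule K_col[OF that(1) IJ(3)[OF Inl(2) that(2)] Inl(2)])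
      moreover from this have "T i j = t" using IJ(4)[OF Inl(2) that(2)] by simp
      ultimately show False using that by (cases a; cases b; cases "\<phi> i j"; simp add: xor3_def)
    qed
    from x(1) show ?thesis
    proof (cases rule: S_cases)
      case l: (Inl i a)
      from x(2) show ?thesis
      proof (cases rule: S_cases)
        case l': (Inl i' a')
        have "K i j = K i' j \<or> T i j = T i' j" using eq Inl l l' by (simp split: if_splits)
        then have "i = i'" using K_col T_col Inl l l' by blast
        then show ?thesis using eq Inl l l' by (auto simp: xor3_inj dest: xor3_inj(5) split: if_splits)
      next
        case r': (Inr t')
        then show ?thesis using mixed[of i t' a] eq Inl l by simp
      qed
    next
      case r: (Inr t)
      from x(2) show ?thesis
      proof (cases rule: S_cases)
        case l': (Inl i' a')
        then show ?thesis using mixed[of i' t a'] eq Inl r by simp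
      next
        case r': (Inr t')
        then have "I j t = I j t'" using eq Inl r K_col[of "I j t" "I j t'" j] IJ by simp
        then have "t = t'" using IJ(4)[OF Inl(2) r(2)] IJ(4)[OF Inl(2) r'(2)] by metis
        then show ?thesis by (simp only: r(1) r'(1))
      qed
    qed
  next
    case (Inr t)
    from x(1) show ?thesis
    proof (cases rule: S_cases)
      case l: (Inl i a)
      from x(2) show ?thesis
      proof (cases rule: S_cases)
        case l': (Inl i' a')
        then have "K i (J i t) = K i' (J i' t)" using eq Inr l by simp
        then have "i = i'" using orth[of i "J i t" i' "J i' t"] IJ Inr l l' by auto
        then show ?thesis using eq Inr l l' by auto
      qed (use eq Inr l in simp)
    next
      case r: (Inr u)
      from x(2) show ?thesis
      proof (cases rule: S_cases)
        case r': (Inr u')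
        then show ?thesis using eq Inr r add_mod_cancel[of t u u'] by (simp add: add.commute)
      qed (use eq Inr r in simp)
    qed
  qed
qed

section \<open>Colour sums of the prolonged square as functions of the flips\<close>

definition color_sum :: "((nat \<times> bool) + nat \<Rightarrow> (nat \<times> bool) + nat \<Rightarrow> int) \<Rightarrow> (nat \<Rightarrow> nat \<Rightarrow> bool)
    \<Rightarrow> (nat \<times> bool) + nat \<Rightarrow> int" where
  "color_sum A \<phi> c = (\<Sum>(x, y) | x \<in> S \<and> y \<in> S \<and> flip_square \<phi> x y = c. A x y)"

text \<open>\<open>False\<close> selects the main diagonal of the block, \<open>True\<close> the
  other one.\<close>

definition diag_sum :: "((nat \<times> bool) + nat \<Rightarrow> (nat \<times> bool) + nat \<Rightarrow> int) \<Rightarrow> nat \<times> nat \<Rightarrow> bool \<Rightarrow> int" where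
  "diag_sum A = (\<lambda>(i, j) s. A (Inl (i, False)) (Inl (j, s)) + A (Inl (i, True)) (Inl (j, \<not> s)))"

definition diag_cells :: "(nat \<times> nat) set \<Rightarrow> (nat \<times> nat \<Rightarrow> bool)
    \<Rightarrow> (((nat \<times> bool) + nat) \<times> ((nat \<times> bool) + nat)) set" where
  "diag_cells P s = {(Inl (i, a), Inl (j, b)) | i j a b. (i, j) \<in> P \<and> b = (a \<noteq> s (i, j))}"

lemma diag_cells_iff:
  "(Inl (i, a), Inl (j, b)) \<in> diag_cells P s \<longleftrightarrow> (i, j) \<in> P \<and> b = (a \<noteq> s (i, j))"
  "(Inl (i, a), Inr t) \<notin> diag_cells P s" "(Inr t, y) \<notin> diag_cells P s"
  unfolding diag_cells_def by blast+

lemma diag_cells_cases: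
  assumes "z \<in> diag_cells P s"
  obtains i j a where "z = (Inl (i, a), Inl (j, a \<noteq> s (i, j)))" "(i, j) \<in> P"
  using assms unfolding diag_cells_def by blast

lemma diag_cells_eq_image:
  "diag_cells P s = (\<lambda>(p, a). (Inl (fst p, a), Inl (snd p, a \<noteq> s p))) ` (P \<times> UNIV)" (is "_ = ?h ` _")
proof (intro equalityI subsetI)
  fix z assume "z \<in> diag_cells P s"
  then obtain i j a where "z = (Inl (i, a), Inl (j, a \<noteq> s (i, j)))" "(i, j) \<in> P"
    by (rule diag_cells_cases)
  then show "z \<in> ?h ` (P \<times> UNIV)"
    by (intro image_eqI[of _ _ "((i, j), a)"]) simp_all
next
  fix z assume "z \<in> ?h ` (P \<times> UNIV)"
  then obtain y where "z = ?h y" "y \<in> P \<times> UNIV" by (rule imageE)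
  then show "z \<in> diag_cells P s" by (cases y; cases "fst y") (simp add: diag_cells_iff)
qed

lemma sum_diag_cells:
  "(\<Sum>(x, y)\<in>diag_cells P s. A x y) = (\<Sum>p\<in>P. diag_sum A p (s p))"
proof -
  let ?h = "\<lambda>(p, a). (Inl (fst p, a), Inl (snd p, a \<noteq> s p)) :: ((nat \<times> bool) + nat) \<times> ((nat \<times> bool) + nat)"
  have "inj_on ?h (P \<times> UNIV)" by (rule inj_onI) (simp add: split_beta prod_eq_iff)
  then have "(\<Sum>(x, y)\<in>diag_cells P s. A x y) = (\<Sum>z\<in>P \<times> UNIV. case ?h z of (x, y) \<Rightarrow> A x y)"
    unfolding diag_cells_eq_image by (simp add: sum.reindex comp_def)
  also have "\<dots> = (\<Sum>p\<in>P. \<Sum>a\<in>UNIV. case ?h (p, a) of (x, y) \<Rightarrow> A x y)"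
    by (simp add: sum.cartesian_product split_beta)
  also have "\<dots> = (\<Sum>p\<in>P. diag_sum A p (s p))"
    by (rule sum.cong) (auto simp: UNIV_bool diag_sum_def)
  finally show ?thesis .
qed

definition free_blocks :: "nat \<Rightarrow> (nat \<times> nat) set" where
  "free_blocks k = {(i, j). i < m \<and> j < m \<and> K i j = k \<and> r \<le> T i j}"

definition transversal_blocks :: "nat \<Rightarrow> (nat \<times> nat) set" where
  "transversal_blocks t = {(i, j). i < m \<and> j < m \<and> T i j = t}"

lemma finite_blocks [simp]: "finite (free_blocks k)" "finite (transversal_blocks t)"
  by (rule finite_subset[of _ "{..<m} \<times> {..<m}"]; auto simp: free_blocks_def transversal_blocks_def)+

text \<open>The flips enter only through the symbol's own transversal, so the new symbols can be
  treated one by one.\<close>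

lemma color_sum_Inr:
  assumes t: "t < r"
  shows "color_sum A \<phi> (Inr t) = (\<Sum>(u, v) | u < r \<and> v < r \<and> (u + v) mod r = t. A (Inr u) (Inr v))
    + (\<Sum>p\<in>transversal_blocks t. diag_sum A p (case_prod \<phi> p))"
proof -
  let ?B = "(\<lambda>(u, v). (Inr u, Inr v) :: ((nat \<times> bool) + nat) \<times> ((nat \<times> bool) + nat)) ` {(u, v). u < r \<and> v < r \<and> (u + v) mod r = t}"
  let ?C = "diag_cells (transversal_blocks t) (case_prod \<phi>)"
  have finB: "finite ?B"
    by (rule finite_imageI, rule finite_subset[of _ "{..<r} \<times> {..<r}"]) auto
  have finC: "finite ?C" unfolding diag_cells_eq_image by simp
  have eq: "{(x, y). x \<in> S \<and> y \<in> S \<and> flip_square \<phi> x y = Inr t} = ?B \<union> ?C"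
  proof (intro equalityI subsetI)
    fix z assume "z \<in> {(x, y). x \<in> S \<and> y \<in> S \<and> flip_square \<phi> x y = Inr t}"
    then obtain x y where z: "z = (x, y)" and x: "x \<in> S" and y: "y \<in> S" and f: "flip_square \<phi> x y = Inr t" by auto
    from x show "z \<in> ?B \<union> ?C"
    proof (cases rule: S_cases)
      case x: (Inl i a)
      from y show ?thesis
      proof (cases rule: S_cases)
        case y: (Inl j b)
        then have "T i j = t" "\<not> xor3 a b (\<phi> i j)" using f x by (simp_all split: if_splits)
        then have "z \<in> ?C" using x y z by (cases a; cases b) (simp_all add: diag_cells_iff transversal_blocks_def xor3_def)
        then show ?thesis by simp
      qed (use f x in simp)
    next
      case x: (Inr u)
      from y show ?thesis
      proof (cases rule: S_cases)
        case y: (Inr v)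
        then have "(u + v) mod r = t" using f x by simp
        then show ?thesis using x y z by auto
      qed (use f x in simp)
    qed
  next
    fix z assume "z \<in> ?B \<union> ?C"
    then show "z \<in> {(x, y). x \<in> S \<and> y \<in> S \<and> flip_square \<phi> x y = Inr t}"
    proof
      assume "z \<in> ?C"
      then obtain i j a where "z = (Inl (i, a), Inl (j, a \<noteq> case_prod \<phi> (i, j)))" "(i, j) \<in> transversal_blocks t"
        by (rule diag_cells_cases)
      then show ?thesis using t by (cases a) (simp_all add: transversal_blocks_def xor3_def)
    qed (use t in auto)
  qed
  have "?B \<inter> ?C = {}" by (auto simp: diag_cells_iff)
  then have "color_sum A \<phi> (Inr t) = (\<Sum>(x, y)\<in>?B. A x y) + (\<Sum>(x, y)\<in>?C. A x y)"
    unfolding color_sum_def eq using finB finC by (simp add: sum.union_disjoint)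
  also have "(\<Sum>(x, y)\<in>?B. A x y) = (\<Sum>(u, v) | u < r \<and> v < r \<and> (u + v) mod r = t. A (Inr u) (Inr v))"
    by (subst sum.reindex) (auto simp: inj_on_def intro: sum.cong)
  finally show ?thesis by (simp add: sum_diag_cells)
qed

definition rest_sum :: "((nat \<times> bool) + nat \<Rightarrow> (nat \<times> bool) + nat \<Rightarrow> int) \<Rightarrow> (nat \<Rightarrow> nat \<Rightarrow> bool)
    \<Rightarrow> nat \<times> bool \<Rightarrow> int" where
  "rest_sum A \<phi> c = (\<Sum>(x, y)\<in>{(x, y). x \<in> S \<and> y \<in> S \<and> flip_square \<phi> x y = Inl c}
    - {(Inl u, Inl v) | u v. r \<le> T (fst u) (fst v)}. A x y)"

text \<open>Cells outside the free blocks see \<open>\<phi>\<close> only on the used transversals,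
  so \<open>rest_sum\<close> is frozen once those flips are fixed. In a free block the symbols
  \<open>(k, False)\<close> and \<open>(k, True)\<close> occupy opposite diagonals, hence the
  \<open>\<noteq> e\<close>.\<close>

lemma color_sum_Inl:
  assumes \<phi>: "\<forall>i<m. \<forall>j<m. T i j < r \<longrightarrow> \<phi> i j = \<phi>' i j"
  shows "color_sum A \<phi> (Inl (k, e)) = rest_sum A \<phi>' (k, e)
    + (\<Sum>p\<in>free_blocks k. diag_sum A p (case_prod \<phi> p \<noteq> e))"
proof -
  define D where "D \<phi> = diag_cells (free_blocks k) (\<lambda>p. case_prod \<phi> p \<noteq> e)" for \<phi>
  define X where "X \<phi> = {(x, y). x \<in> S \<and> y \<in> S \<and> flip_square \<phi> x y = Inl (k, e)}" for \<phi>
  define Y :: "(((nat \<times> bool) + nat) \<times> ((nat \<times> bool) + nat)) set"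
    where "Y = {(Inl u, Inl v) | u v. r \<le> T (fst u) (fst v)}"
  have free: "D \<phi> = X \<phi> \<inter> Y" for \<phi>
  proof (intro equalityI subsetI)
    fix z assume "z \<in> D \<phi>"
    then obtain i j a where "z = (Inl (i, a), Inl (j, a \<noteq> (case_prod \<phi> (i, j) \<noteq> e)))" "(i, j) \<in> free_blocks k"
      unfolding D_def by (rule diag_cells_cases)
    then show "z \<in> X \<phi> \<inter> Y"
      by (cases a; cases e; cases "\<phi> i j") (simp_all add: free_blocks_def xor3_def X_def Y_def ex_bool_eq)
  next
    fix z assume "z \<in> X \<phi> \<inter> Y"
    then have zX: "z \<in> X \<phi>" and zY: "z \<in> Y" by simp_all
    from zY obtain u v where uv: "z = (Inl u, Inl v)" "r \<le> T (fst u) (fst v)" unfolding Y_def by blast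
    obtain i a where u: "u = (i, a)" by (cases u)
    obtain j b where v: "v = (j, b)" by (cases v)
    have "z = (Inl (i, a), Inl (j, b))" "i < m" "j < m" "r \<le> T i j" "K i j = k" "xor3 a b (\<phi> i j) = e"
      using uv u v zX by (simp_all add: X_def)
    then show "z \<in> D \<phi>"
      by (cases a; cases b; cases "\<phi> i j"; cases e) (simp_all add: D_def free_blocks_def diag_cells_iff xor3_def)
  qed
  have fin: "finite (X \<phi>)" for \<phi> by (rule finite_subset[of _ "S \<times> S"]) (auto simp: X_def)
  have split: "color_sum A \<phi> (Inl (k, e)) = (\<Sum>(x, y)\<in>X \<phi> - Y. A x y)
      + (\<Sum>p\<in>free_blocks k. diag_sum A p (case_prod \<phi> p \<noteq> e))" for \<phi>
    using sum.Int_Diff[OF fin, of "\<lambda>(x, y). A x y" \<phi> Y]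
    unfolding color_sum_def X_def[symmetric] sum_diag_cells[symmetric] D_def[symmetric] free
    by simp
  have const: "X \<phi> - Y = X \<phi>' - Y"
  proof -
    have "flip_square \<phi> x y = flip_square \<phi>' x y" if "x \<in> S" "y \<in> S" "(x, y) \<notin> Y" for x y
      using that(1)
    proof (cases rule: S_cases)
      case x: (Inl i a)
      from that(2) show ?thesis
      proof (cases rule: S_cases)
        case y: (Inl j b)
        then have "\<not> r \<le> T i j" using that(3) x by (auto simp: Y_def)
        then show ?thesis using x y \<phi> by simp
      qed (simp add: x)
    next
      case x: (Inr t)
      from that(2) show ?thesis
      proof (cases rule: S_cases)
        case y: (Inl j b)
        then have "T (I j t) j < r" "I j t < m" using IJ[of j t] x by auto
        then show ?thesis using x y \<phi> by simp
      qed (simp add: x)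
    qed
    then show ?thesis by (auto simp: X_def)
  qed
  show ?thesis unfolding split const unfolding X_def Y_def rest_sum_def ..
qed

text \<open>Two rounds. Flips on the transversals settle the new symbols and freeze
  \<open>rest_sum\<close>; flips in the free blocks with \<open>K = k\<close> then serve
  \<open>(k, False)\<close> and \<open>(k, True)\<close> together. The summand \<open>r\<close> in
  \<open>free\<close> pays for the blocks lost to the transversals.\<close>

lemma ex_flips_color_sums_ge:
  fixes q :: int
  assumes q0: "0 \<le> q"
    and free: "\<And>k. k < m \<Longrightarrow> 4 * q + r \<le> card {p \<in> {(i, j). i < m \<and> j < m \<and> K i j = k}. diag_sum A p True \<noteq> diag_sum A p False}"
    and tr: "\<And>t. t < r \<Longrightarrow> 2 * q \<le> card {p \<in> transversal_blocks t. diag_sum A p True \<noteq> diag_sum A p False}"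
  shows "\<exists>\<phi>. \<forall>c\<in>S. \<bar>color_sum A \<phi> c\<bar> \<ge> q"
proof -
  have "\<exists>\<psi>. \<forall>t. t < r \<longrightarrow> \<bar>(\<Sum>(u, v) | u < r \<and> v < r \<and> (u + v) mod r = t. A (Inr u) (Inr v))
    + (\<Sum>p\<in>transversal_blocks t. diag_sum A p (\<psi> t p))\<bar> \<ge> q"
  proof (rule choice, intro allI)
    fix t
    show "\<exists>\<psi>. t < r \<longrightarrow> \<bar>(\<Sum>(u, v) | u < r \<and> v < r \<and> (u + v) mod r = t. A (Inr u) (Inr v))
      + (\<Sum>p\<in>transversal_blocks t. diag_sum A p (\<psi> p))\<bar> \<ge> q"
    proof (cases "t < r")
      case True
      show ?thesis
        using ex_flips_sum_ge[OF finite_blocks(2) tr[OF True]] by (simp only: True simp_thms)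
    qed simp
  qed
  then obtain \<psi> where \<psi>: "\<forall>t. t < r \<longrightarrow> \<bar>(\<Sum>(u, v) | u < r \<and> v < r \<and> (u + v) mod r = t. A (Inr u) (Inr v))
    + (\<Sum>p\<in>transversal_blocks t. diag_sum A p (\<psi> t p))\<bar> \<ge> q" by (rule exE)
  \<comment> \<open>Different transversals are disjoint, so the separate choices combine into one
    function.\<close>
  define \<phi>0 where "\<phi>0 i j = \<psi> (T i j) (i, j)" for i j
  define C where "C k e = rest_sum A \<phi>0 (k, e)" for k e
  have card: "4 * q \<le> card {p \<in> free_blocks k. diag_sum A p True \<noteq> diag_sum A p False}" if k: "k < m" for k
  proof -
    let ?P = "{(i, j). i < m \<and> j < m \<and> K i j = k}"
    let ?Q = "{p \<in> ?P. case_prod T p < r}"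
    \<comment> \<open>By orthogonality a class of \<open>K\<close> meets each transversal at most
      once, so at most \<open>r\<close> of its blocks are not free.\<close>
    have inj: "inj_on (case_prod T) ?Q"
    proof (rule inj_onI)
      fix p p' assume "p \<in> ?Q" "p' \<in> ?Q" "case_prod T p = case_prod T p'"
      then show "p = p'" using orth[of "fst p" "snd p" "fst p'" "snd p'"]
        by (cases p; cases p') simp
    qed
    have sub: "case_prod T ` ?Q \<subseteq> {..<r}" by auto
    have Q: "card ?Q \<le> r" using card_inj_on_le[OF inj sub] by simp
    have fin: "finite ?P" by (rule finite_subset[of _ "{..<m} \<times> {..<m}"]) auto
    have "card {p \<in> ?P. diag_sum A p True \<noteq> diag_sum A p False}
      \<le> card ({p \<in> free_blocks k. diag_sum A p True \<noteq> diag_sum A p False} \<union> ?Q)"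
    proof (rule card_mono)
      show "finite ({p \<in> free_blocks k. diag_sum A p True \<noteq> diag_sum A p False} \<union> ?Q)"
        using fin by simp
    qed (auto simp: free_blocks_def)
    also have "\<dots> \<le> card {p \<in> free_blocks k. diag_sum A p True \<noteq> diag_sum A p False} + card ?Q"
      by (rule card_Un_le)
    finally show ?thesis using free[OF k] Q by linarith
  qed
  have "\<exists>\<chi>. \<forall>k. k < m \<longrightarrow> \<bar>C k False + (\<Sum>p\<in>free_blocks k. diag_sum A p (\<chi> k p))\<bar> \<ge> q
    \<and> \<bar>C k True + (\<Sum>p\<in>free_blocks k. diag_sum A p (\<not> \<chi> k p))\<bar> \<ge> q"
  proof (rule choice, intro allI)
    fix k
    show "\<exists>\<chi>. k < m \<longrightarrow> \<bar>C k False + (\<Sum>p\<in>free_blocks k. diag_sum A p (\<chi> p))\<bar> \<ge> q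
      \<and> \<bar>C k True + (\<Sum>p\<in>free_blocks k. diag_sum A p (\<not> \<chi> p))\<bar> \<ge> q"
    proof (cases "k < m")
      case True
      show ?thesis
        using ex_flips_both_sums_ge[OF finite_blocks(1) q0 card[OF True]] by (simp only: True simp_thms)
    qed simp
  qed
  then obtain \<chi> where \<chi>: "\<forall>k. k < m \<longrightarrow> \<bar>C k False + (\<Sum>p\<in>free_blocks k. diag_sum A p (\<chi> k p))\<bar> \<ge> q
    \<and> \<bar>C k True + (\<Sum>p\<in>free_blocks k. diag_sum A p (\<not> \<chi> k p))\<bar> \<ge> q" by (rule exE)
  define \<phi> where "\<phi> i j = (if T i j < r then \<phi>0 i j else \<chi> (K i j) (i, j))" for i j
  have agree: "\<forall>i<m. \<forall>j<m. T i j < r \<longrightarrow> \<phi> i j = \<phi>0 i j" by (simp add: \<phi>_def)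
  have \<phi>_free: "case_prod \<phi> p = \<chi> k p" if "p \<in> free_blocks k" for p k
    using that by (auto simp: free_blocks_def \<phi>_def)
  have \<phi>_tr: "case_prod \<phi> p = \<psi> t p" if "p \<in> transversal_blocks t" "t < r" for p t
    using that by (auto simp: transversal_blocks_def \<phi>_def \<phi>0_def)
  have "\<bar>color_sum A \<phi> c\<bar> \<ge> q" if "c \<in> S" for c
    using that
  proof (cases rule: S_cases)
    case (Inl k e)
    have "color_sum A \<phi> c = C k e + (\<Sum>p\<in>free_blocks k. diag_sum A p (\<chi> k p \<noteq> e))"
      unfolding Inl(1) C_def color_sum_Inl[OF agree] by (simp add: \<phi>_free cong: sum.cong)
    then show ?thesis using \<chi>[rule_format, OF Inl(2)] by (cases e) simp_all
  next
    case (Inr t)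
    have "(\<Sum>p\<in>transversal_blocks t. diag_sum A p (case_prod \<phi> p)) = (\<Sum>p\<in>transversal_blocks t. diag_sum A p (\<psi> t p))"
      by (rule sum.cong) (simp_all add: \<phi>_tr Inr(2))
    then show ?thesis using \<psi>[rule_format, OF Inr(2)] by (simp add: Inr(1) color_sum_Inr[OF Inr(2)])
  qed
  then show ?thesis by (intro exI[of _ \<phi>] ballI)
qed

end

section \<open>Construction of the 1-factorizations\<close>

lemma sum_color_class:
  assumes S: "finite S" and p: "p permutes S" and L: "\<forall>x\<in>S. \<forall>y\<in>S. L x y = c \<longleftrightarrow> y = p x"
  shows "(\<Sum>(x, y) | x \<in> S \<and> y \<in> S \<and> L x y = c. g x y) = (\<Sum>x\<in>S. g x (p x))"
proof -
  have "{(x, y). x \<in> S \<and> y \<in> S \<and> L x y = c} = (\<lambda>x. (x, p x)) ` S"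
    using L permutes_in_image[OF p] by auto
  then show ?thesis by (simp add: sum.reindex inj_on_def)
qed

lemma card_pairs_eq_sum:
  fixes n :: nat
  shows "real (card {(i, j). i < n \<and> j < n \<and> P i j}) = (\<Sum>i<n. \<Sum>j<n. of_bool (P i j))"
proof -
  have "{(i, j). i < n \<and> j < n \<and> P i j} = (SIGMA i:{..<n}. {j. j < n \<and> P i j})" by auto
  moreover have "real (card {j. j < n \<and> P i j}) = (\<Sum>j<n. of_bool (P i j))" for i
    by (simp add: Int_def)
  ultimately show ?thesis by simp
qed

text \<open>In the randomly relabelled cyclic square a colour class has as mean the entry sum over
  \<open>n\<close>, in absolute value at least \<open>\<mu> * n\<close>; concentration costs
  \<open>s * n\<close> for all \<open>n\<close> classes at once.\<close>

lemma ex_factorization_of_large_sum: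
  assumes \<sigma>: "signing n \<sigma>" and s: "0 < s" "s \<le> 1" and n: "n > 0"
    and small: "n * exp (- (s\<^sup>2 * n / 64)) < 1"
    and large: "real_of_int \<bar>\<Sum>i<n. \<Sum>j<n. \<sigma> {Inl i, Inr j}\<bar> \<ge> \<mu> * (real n)\<^sup>2"
  shows "\<exists>F. one_factorization (Knn_verts n) (Knn_edges n) F \<and> (\<forall>M\<in>F. discrepancy \<sigma> M \<ge> \<mu> - s)"
proof -
  define M where "M i j = \<sigma> {Inl i, Inr j}" for i j :: nat
  define L where "L i j = (i + j) mod n" for i j
  \<comment> \<open>Multiplying by the sign of the total leaves only lower tails to control.\<close>
  define e :: int where "e = (if (\<Sum>i<n. \<Sum>j<n. M i j) \<ge> 0 then 1 else -1)"
  \<comment> \<open>Cut off outside the square, as the concentration lemma asks for a bound at all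
    indices.\<close>
  define w where "w i j = (if i < n \<and> j < n then real_of_int (e * M i j) else 0)" for i j
  have M: "M i j \<in> {-1, 1}" if "i < n" "j < n" for i j
    using \<sigma> that unfolding signing_def Knn_edges_def M_def by blast
  have w: "\<bar>w i j\<bar> \<le> 1" for i j using M[of i j] by (auto simp: w_def e_def)
  have "(\<Sum>i<n. \<Sum>j<n. w i j) = real_of_int (e * (\<Sum>i<n. \<Sum>j<n. M i j))"
    by (simp add: w_def sum_distrib_left)
  also have "e * (\<Sum>i<n. \<Sum>j<n. M i j) = \<bar>\<Sum>i<n. \<Sum>j<n. M i j\<bar>" by (simp add: e_def)
  finally have W: "(\<Sum>i<n. \<Sum>j<n. w i j) \<ge> \<mu> * (real n)\<^sup>2" using large by (simp add: M_def)
  have latin: "latin {..<n} L" unfolding L_def by (rule latin_add_mod)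
  have "\<forall>c. \<exists>p. c < n \<longrightarrow> p permutes {..<n} \<and> (\<forall>x\<in>{..<n}. \<forall>y\<in>{..<n}. L x y = c \<longleftrightarrow> y = p x)"
    using latin_color_class_permutes[OF _ latin] by auto
  then obtain p where p: "\<forall>c. c < n \<longrightarrow> p c permutes {..<n} \<and> (\<forall>x\<in>{..<n}. \<forall>y\<in>{..<n}. L x y = c \<longleftrightarrow> y = p c x)"
    by (rule choice[THEN exE])
  have "card (p ` {..<n}) \<le> n" using card_image_le[of "{..<n}" p] by simp
  then have "real (card (p ` {..<n})) * exp (- (s\<^sup>2 * n / 64)) \<le> n * exp (- (s\<^sup>2 * n / 64))"
    by (intro mult_right_mono) auto
  then obtain \<rho> where \<rho>: "\<rho> permutes {..<n}"
    "\<forall>\<pi>\<in>p ` {..<n}. (\<Sum>i<n. w i (\<rho> (\<pi> i))) \<ge> (\<Sum>i<n. \<Sum>j<n. w i j) / n - s * n"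
    using ex_permutes_all_sums_ge[of w s "p ` {..<n}" n] w s small p by fastforce
  show ?thesis
  proof (rule one_factorization_of_latin[OF _ latin, where f = id and g = \<rho> and q = "\<lceil>(\<mu> - s) * n\<rceil>"])
    show "bij_betw \<rho> {..<n} {..<n}" using \<rho>(1) by (rule permutes_imp_bij)
    fix c assume c: "c \<in> {..<n}"
    have pc: "p c permutes {..<n}" using p c by simp
    have "(\<mu> - s) * n = \<mu> * (real n)\<^sup>2 / n - s * n" using n by (simp add: power2_eq_square algebra_simps)
    also have "\<dots> \<le> (\<Sum>i<n. \<Sum>j<n. w i j) / n - s * n" using W n by (simp add: divide_right_mono)
    also have "\<dots> \<le> (\<Sum>i<n. w i (\<rho> (p c i)))" using \<rho>(2) c by simp
    also have "\<dots> = real_of_int (e * (\<Sum>i<n. M i (\<rho> (p c i))))"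
      using permutes_in_image[OF \<rho>(1)] permutes_in_image[OF pc] by (simp add: w_def sum_distrib_left)
    also have "\<dots> \<le> real_of_int \<bar>\<Sum>i<n. M i (\<rho> (p c i))\<bar>"
      unfolding of_int_le_iff by (simp add: e_def abs_ge_self abs_ge_minus_self)
    finally have "\<lceil>(\<mu> - s) * n\<rceil> \<le> \<bar>\<Sum>i<n. M i (\<rho> (p c i))\<bar>" by (simp add: ceiling_le_iff)
    also have "(\<Sum>i<n. M i (\<rho> (p c i))) = (\<Sum>(x, y) | x \<in> {..<n} \<and> y \<in> {..<n} \<and> L x y = c. M x (\<rho> y))"
      using p c by (intro sum_color_class[symmetric]) auto
    finally show "\<bar>\<Sum>(x, y) | x \<in> {..<n} \<and> y \<in> {..<n} \<and> L x y = c. \<sigma> {Inl (id x), Inr (\<rho> y)}\<bar> \<ge> \<lceil>(\<mu> - s) * n\<rceil>"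
      by (simp add: M_def)
  qed auto
qed

section \<open>Orthogonal cyclic squares and the labelling of their doubles\<close>

lemma latin_double_add_mod:
  fixes m :: nat
  assumes "odd m"
  shows "latin {..<m} (\<lambda>i j. (2 * i + j) mod m)"
proof -
  have row: "j = j'" if "(2 * i + j) mod m = (2 * i + j') mod m" "j < m" "j' < m" for i j j'
    using that cong_add_lcancel_nat[of "2 * i" j j' m] by (simp add: cong_def)
  have column: "i = i'" if "(2 * i + j) mod m = (2 * i' + j) mod m" "i < m" "i' < m" for i i' j
  proof -
    have "[2 * i = 2 * i'] (mod m)"
      using that(1) cong_add_rcancel_nat[of "2 * i" j "2 * i'" m] by (simp add: cong_def)
    \<comment> \<open>Since \<open>m\<close> is odd, 2 can be cancelled modulo
      \<open>m\<close>.\<close>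
    then have "[i = i'] (mod m)" using assms by (simp add: cong_mult_lcancel_nat)
    then show ?thesis using that by (simp add: cong_def)
  qed
  have "inj_on (\<lambda>j. (2 * i + j) mod m) {..<m}" for i
    by (rule inj_onI, rule row) simp_all
  moreover have "inj_on (\<lambda>i. (2 * i + j) mod m) {..<m}" for j
    by (rule inj_onI, rule column) simp_all
  ultimately show ?thesis unfolding latin_def by simp
qed

text \<open>The residues of \<open>i + j\<close> and \<open>2 * i + j\<close> determine their
  difference \<open>i\<close>, and then \<open>j\<close>.\<close>

lemma ex_orthogonal_squares:
  assumes m: "odd m" and r: "r \<le> m"
  shows "\<exists>I J. orthogonal_squares m r (\<lambda>i j. (i + j) mod m) (\<lambda>i j. (2 * i + j) mod m) I J"
proof -
  let ?T = "\<lambda>i j. (2 * i + j) mod m"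
  note T = latin_double_add_mod[OF m]
  have "\<forall>i. \<exists>f. \<forall>t. i < m \<longrightarrow> t < m \<longrightarrow> f t < m \<and> ?T i (f t) = t"
  proof (intro allI choice)
    fix i t
    show "\<exists>y. i < m \<longrightarrow> t < m \<longrightarrow> y < m \<and> ?T i y = t"
      using latin_ex1_column[OF finite_lessThan T, of i t] by (cases "i < m \<and> t < m") auto
  qed
  then obtain J where J: "\<forall>i t. i < m \<longrightarrow> t < m \<longrightarrow> J i t < m \<and> ?T i (J i t) = t"
    by (rule choice[THEN exE])
  have "\<forall>j. \<exists>f. \<forall>t. j < m \<longrightarrow> t < m \<longrightarrow> f t < m \<and> ?T (f t) j = t"
  proof (intro allI choice)
    fix j t
    show "\<exists>y. j < m \<longrightarrow> t < m \<longrightarrow> y < m \<and> ?T y j = t"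
      using latin_ex1_row[OF finite_lessThan T, of j t] by (cases "j < m \<and> t < m") auto
  qed
  then obtain I where I: "\<forall>j t. j < m \<longrightarrow> t < m \<longrightarrow> I j t < m \<and> ?T (I j t) j = t"
    by (rule choice[THEN exE])
  have orth: "i = i' \<and> j = j'"
    if "i < m" "j < m" "i' < m" "j' < m" "(i + j) mod m = (i' + j') mod m" "?T i j = ?T i' j'" for i j i' j'
  proof -
    \<comment> \<open>In this form the subtraction of congruences becomes a cancellation on the
      naturals.\<close>
    have "2 * i + j = i + (i + j)" "2 * i' + j' = i' + (i' + j')" by simp_all
    then have 1: "[i + (i + j) = i' + (i' + j')] (mod m)" using that(6) by (simp only: cong_def)
    have "[i + j = i' + j'] (mod m)" using that(5) by (simp only: cong_def)
    then have 2: "[i' + (i + j) = i' + (i' + j')] (mod m)" by (simp only: cong_add_lcancel_nat)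
    have "[i + (i + j) = i' + (i + j)] (mod m)" by (rule cong_trans[OF 1 cong_sym[OF 2]])
    then have "i = i'" using that(1,3) unfolding cong_add_rcancel_nat by (simp only: cong_def mod_less)
    moreover from this have "[i + j = i + j'] (mod m)" using that(5) by (simp only: cong_def)
    then have "j = j'" using that(2,4) unfolding cong_add_lcancel_nat by (simp only: cong_def mod_less)
    ultimately show ?thesis ..
  qed
  have "orthogonal_squares m r (\<lambda>i j. (i + j) mod m) ?T I J"
  proof (rule orthogonal_squares.intro)
    show "r \<le> m" by (rule r)
    show "latin {..<m} (\<lambda>i j. (i + j) mod m)" by (rule latin_add_mod)
    show "latin {..<m} ?T" by (rule T)
  next
    fix i j i' j'
    assume "i < m" "j < m" "i' < m" "j' < m" "(i + j) mod m = (i' + j') mod m" "?T i j = ?T i' j'"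
    then show "i = i' \<and> j = j'" by (rule orth)
  next
    fix i t assume "i < m" "t < m"
    then show "J i t < m \<and> ?T i (J i t) = t" using J by simp
  next
    fix j t assume "j < m" "t < m"
    then show "I j t < m \<and> ?T (I j t) j = t" using I by simp
  qed
  then show ?thesis by blast
qed

text \<open>Block index \<open>i\<close> receives the positions \<open>2 * i\<close> and
  \<open>2 * i + 1\<close>, matching the pairs of \<open>ex_pairings_many_unbalanced\<close>; the
  \<open>r\<close> new lines come last.\<close>

lemma bij_betw_label:
  "bij_betw (case_sum (\<lambda>(i, a). 2 * i + of_bool a) (\<lambda>t. 2 * m + t)) (({..<m} \<times> UNIV) <+> {..<r}) {..<2 * m + r :: nat}"
  (is "bij_betw ?e ?S _")
proof (rule bij_betw_imageI)
  show "inj_on ?e ?S"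
  proof (rule inj_onI)
    fix x y assume "x \<in> ?S" "y \<in> ?S" "?e x = ?e y"
    then show "x = y" by (auto split: if_splits simp: of_bool_def; presburger)
  qed
  show "?e ` ?S = {..<2 * m + r}"
  proof (intro equalityI subsetI)
    fix x assume "x \<in> {..<2 * m + r}"
    then show "x \<in> ?e ` ?S"
    proof (cases "x < 2 * m")
      case True
      then have "Inl (x div 2, odd x) \<in> ?S" "x = ?e (Inl (x div 2, odd x))" by auto
      then show ?thesis by (rule rev_image_eqI)
    next
      case False
      then have "Inr (x - 2 * m) \<in> ?S" "x = ?e (Inr (x - 2 * m))" using \<open>x \<in> _\<close> by auto
      then show ?thesis by (rule rev_image_eqI)
    qed
  qed (auto simp: of_bool_def)
qed

text \<open>Good pairings give an \<open>m\<close> by \<open>m\<close> array \<open>w\<close> of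
  zeros and ones with density at least \<open>\<delta>\<close>, marking the blocks where an exchange
  has an effect. After a random permutation of the column pairs every class of \<open>K\<close> and
  of \<open>T\<close> contains at least \<open>(\<delta> - s) * m\<close> of them, enough for the
  flips.\<close>

lemma ex_factorization_of_many_unbalanced:
  assumes m: "odd m" and r: "r \<le> m" and n: "n = 2 * m + r"
    and s: "0 < s" "s \<le> 1" and small: "2 * real m * exp (- (s\<^sup>2 * m / 64)) < 1"
    and many: "unbalanced_count n (\<lambda>i j. \<sigma> {Inl i, Inr j}) \<ge> \<delta> * real n ^ 4"
    and q: "0 \<le> q" "4 * q + r \<le> (\<delta> - s) * m" and d: "d * n \<le> real_of_int q"
  shows "\<exists>F. one_factorization (Knn_verts n) (Knn_edges n) F \<and> (\<forall>M\<in>F. discrepancy \<sigma> M \<ge> d)"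
proof -
  define M where "M i j = \<sigma> {Inl i, Inr j}" for i j :: nat
  define K where "K = (\<lambda>i j. (i + j) mod m)"
  define T where "T = (\<lambda>i j. (2 * i + j) mod m)"
  have m0: "m > 0" using m by (cases m) auto
  obtain I J where "orthogonal_squares m r K T I J"
    using ex_orthogonal_squares[OF m r] unfolding K_def T_def by blast
  then interpret orthogonal_squares m r K T I J .
  obtain p p' where p: "p permutes {..<n}" "p' permutes {..<n}"
    "(\<Sum>a<m. \<Sum>b<m. of_bool (unbalanced M (p (2 * a)) (p (2 * a + 1)) (p' (2 * b)) (p' (2 * b + 1))))
      \<ge> \<delta> * (real m)\<^sup>2"
    using ex_pairings_many_unbalanced[of m n \<delta> M] n m0 many unfolding M_def by auto
  define w where "w a b = (of_bool (unbalanced M (p (2 * a)) (p (2 * a + 1)) (p' (2 * b)) (p' (2 * b + 1))) :: real)" for a b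
  have "\<forall>c. \<exists>\<pi>. c < m \<longrightarrow> \<pi> permutes {..<m} \<and> (\<forall>x\<in>{..<m}. \<forall>y\<in>{..<m}. K x y = c \<longleftrightarrow> y = \<pi> x)"
    using latin_color_class_permutes[OF _ K] by auto
  then obtain \<pi>K where \<pi>K: "\<forall>c. c < m \<longrightarrow> \<pi>K c permutes {..<m} \<and> (\<forall>x\<in>{..<m}. \<forall>y\<in>{..<m}. K x y = c \<longleftrightarrow> y = \<pi>K c x)"
    by (rule choice[THEN exE])
  have "\<forall>c. \<exists>\<pi>. c < m \<longrightarrow> \<pi> permutes {..<m} \<and> (\<forall>x\<in>{..<m}. \<forall>y\<in>{..<m}. T x y = c \<longleftrightarrow> y = \<pi> x)"
    using latin_color_class_permutes[OF _ T] by auto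
  then obtain \<pi>T where \<pi>T: "\<forall>c. c < m \<longrightarrow> \<pi>T c permutes {..<m} \<and> (\<forall>x\<in>{..<m}. \<forall>y\<in>{..<m}. T x y = c \<longleftrightarrow> y = \<pi>T c x)"
    by (rule choice[THEN exE])
  \<comment> \<open>At most \<open>2 * m\<close> permutations, \<open>m\<close> for each of the two
    squares; hence the factor 2 in \<open>small\<close>.\<close>
  define P where "P = \<pi>K ` {..<m} \<union> \<pi>T ` {..<m}"
  have "card P \<le> card (\<pi>K ` {..<m}) + card (\<pi>T ` {..<m})" unfolding P_def by (rule card_Un_le)
  also have "\<dots> \<le> m + m" using card_image_le[of "{..<m}" \<pi>K] card_image_le[of "{..<m}" \<pi>T] by simp
  finally have "real (card P) \<le> 2 * real m" by simp
  then have "card P * exp (- (s\<^sup>2 * m / 64)) \<le> 2 * real m * exp (- (s\<^sup>2 * m / 64))"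
    by (intro mult_right_mono) auto
  then have "card P * exp (- (s\<^sup>2 * m / 64)) < 1" using small by linarith
  moreover have "P \<subseteq> {\<pi>. \<pi> permutes {..<m}}" using \<pi>K \<pi>T by (auto simp: P_def)
  moreover have "finite P" by (simp add: P_def)
  moreover have "\<bar>w i j\<bar> \<le> 1" for i j by (simp add: w_def)
  ultimately obtain \<rho> where \<rho>: "\<rho> permutes {..<m}"
    "\<forall>\<pi>\<in>P. (\<Sum>i<m. w i (\<rho> (\<pi> i))) \<ge> (\<Sum>i<m. \<Sum>j<m. w i j) / m - s * m"
    using ex_permutes_all_sums_ge[of w s P m] s by blast
  have "(\<delta> - s) * m = \<delta> * (real m)\<^sup>2 / m - s * m" using m0 by (simp add: power2_eq_square algebra_simps)
  also have "\<dots> \<le> (\<Sum>i<m. \<Sum>j<m. w i j) / m - s * m"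
    using p(3) m0 by (simp add: w_def divide_right_mono)
  finally have ge: "4 * q + r \<le> (\<Sum>i<m. w i (\<rho> (\<pi> i)))" if "\<pi> \<in> P" for \<pi>
    using \<rho>(2) that q(2) by fastforce
  define e where "e = (case_sum (\<lambda>(i, a). 2 * i + of_bool a) (\<lambda>t. 2 * m + t) :: (nat \<times> bool) + nat \<Rightarrow> nat)"
  \<comment> \<open>Moves whole column pairs by \<open>\<rho>\<close>, keeping the place within a
    pair and fixing the \<open>r\<close> new columns.\<close>
  define h where "h = (map_sum (map_prod \<rho> id) id :: (nat \<times> bool) + nat \<Rightarrow> (nat \<times> bool) + nat)"
  have e: "bij_betw e S {..<n}" unfolding e_def S_def n by (rule bij_betw_label)
  have "inj \<rho>" using permutes_inj[OF \<rho>(1)] .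
  then have "inj h" unfolding h_def by (intro sum.inj_map prod.inj_map inj_on_id)
  then have "inj_on h S" by (rule inj_on_subset) simp
  moreover have "h ` S \<subseteq> S"
  proof (rule image_subsetI)
    fix x assume "x \<in> S"
    then show "h x \<in> S"
    proof (cases rule: S_cases)
      case (Inl j b)
      then show ?thesis using permutes_in_image[OF \<rho>(1), of j] by (simp add: h_def)
    next
      case (Inr t)
      then show ?thesis by (simp add: h_def)
    qed
  qed
  ultimately have h: "bij_betw h S S" by (simp add: bij_betw_def endo_inj_surj[OF finite_S])
  define f where "f = p \<circ> e"
  define g where "g = p' \<circ> (e \<circ> h)"
  have f: "bij_betw f S {..<n}" unfolding f_def
    by (rule bij_betw_trans[OF e permutes_imp_bij[OF p(1)]])
  have g: "bij_betw g S {..<n}" unfolding g_def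
    by (rule bij_betw_trans[OF bij_betw_trans[OF h e] permutes_imp_bij[OF p(2)]])
  define A where "A x y = M (f x) (g y)" for x y
  have diag: "diag_sum A (i, j) True \<noteq> diag_sum A (i, j) False \<longleftrightarrow> w i (\<rho> j) = 1" for i j
    by (auto simp: diag_sum_def A_def f_def g_def e_def h_def w_def unbalanced_def)
  have count: "real (card {z \<in> {(i, j). i < m \<and> j < m \<and> L i j = c}. diag_sum A z True \<noteq> diag_sum A z False})
      = (\<Sum>i<m. w i (\<rho> (\<pi> i)))"
    if \<pi>: "\<pi> permutes {..<m}" "\<forall>x\<in>{..<m}. \<forall>y\<in>{..<m}. L x y = c \<longleftrightarrow> y = \<pi> x" for L \<pi> and c :: nat
  proof -
    have "{z \<in> {(i, j). i < m \<and> j < m \<and> L i j = c}. diag_sum A z True \<noteq> diag_sum A z False}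
      = (\<lambda>i. (i, \<pi> i)) ` {i. i < m \<and> w i (\<rho> (\<pi> i)) = 1}"
    proof (intro equalityI subsetI)
      fix z assume z: "z \<in> {z \<in> {(i, j). i < m \<and> j < m \<and> L i j = c}. diag_sum A z True \<noteq> diag_sum A z False}"
      obtain i j where ij: "z = (i, j)" by (cases z)
      then have "i < m" "j < m" "L i j = c" "w i (\<rho> j) = 1" using z diag[of i j] by simp_all
      then show "z \<in> (\<lambda>i. (i, \<pi> i)) ` {i. i < m \<and> w i (\<rho> (\<pi> i)) = 1}"
        using \<pi>(2) ij by simp
    next
      fix z assume "z \<in> (\<lambda>i. (i, \<pi> i)) ` {i. i < m \<and> w i (\<rho> (\<pi> i)) = 1}"
      then obtain i where i: "z = (i, \<pi> i)" "i < m" "w i (\<rho> (\<pi> i)) = 1" by blast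
      have "\<pi> i < m" using permutes_in_image[OF \<pi>(1), of i] i(2) by simp
      then show "z \<in> {z \<in> {(i, j). i < m \<and> j < m \<and> L i j = c}. diag_sum A z True \<noteq> diag_sum A z False}"
        using i \<pi>(2) diag[of i "\<pi> i"] by simp
    qed
    moreover have "inj_on (\<lambda>i. (i, \<pi> i)) X" for X by (simp add: inj_on_def)
    ultimately have "real (card {z \<in> {(i, j). i < m \<and> j < m \<and> L i j = c}. diag_sum A z True \<noteq> diag_sum A z False})
      = card {i. i < m \<and> w i (\<rho> (\<pi> i)) = 1}" by (simp add: card_image)
    also have "\<dots> = (\<Sum>i<m. of_bool (w i (\<rho> (\<pi> i)) = 1))" by (simp add: Int_def)
    also have "\<dots> = (\<Sum>i<m. w i (\<rho> (\<pi> i)))" by (rule sum.cong) (auto simp: w_def)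
    finally show ?thesis .
  qed
  have "\<exists>\<phi>. \<forall>c\<in>S. \<bar>color_sum A \<phi> c\<bar> \<ge> q"
  proof (rule ex_flips_color_sums_ge[OF q(1)])
    fix k assume k: "k < m"
    have "4 * q + r \<le> real (card {z \<in> {(i, j). i < m \<and> j < m \<and> K i j = k}. diag_sum A z True \<noteq> diag_sum A z False})"
      using \<pi>K k ge[of "\<pi>K k"] count[of "\<pi>K k" K k] by (simp add: P_def)
    then show "4 * q + int r \<le> int (card {z \<in> {(i, j). i < m \<and> j < m \<and> K i j = k}. diag_sum A z True \<noteq> diag_sum A z False})"
      by linarith
  next
    fix t assume "t < r"
    then have t: "t < m" using r by simp
    have "4 * q + r \<le> real (card {z \<in> {(i, j). i < m \<and> j < m \<and> T i j = t}. diag_sum A z True \<noteq> diag_sum A z False})"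
      using \<pi>T t ge[of "\<pi>T t"] count[of "\<pi>T t" T t] by (simp add: P_def)
    then show "2 * q \<le> int (card {z \<in> transversal_blocks t. diag_sum A z True \<noteq> diag_sum A z False})"
      unfolding transversal_blocks_def using q(1) by linarith
  qed
  then obtain \<phi> where \<phi>: "\<forall>c\<in>S. \<bar>color_sum A \<phi> c\<bar> \<ge> q" by blast
  show ?thesis
  proof (rule one_factorization_of_latin[OF finite_S latin_flip_square f g _ d])
    fix c assume "c \<in> S"
    then show "\<bar>\<Sum>(x, y) | x \<in> S \<and> y \<in> S \<and> flip_square \<phi> x y = c. \<sigma> {Inl (f x), Inr (g y)}\<bar> \<ge> q"
      using \<phi> by (simp add: color_sum_def A_def M_def)
  qed
qed

section \<open>Signings close to balanced one-sided ones\<close>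

lemma balanced_one_sided_of_balanced_vector:
  assumes z: "balanced_vector n (vec n z)"
  shows "\<exists>\<sigma>'. balanced_one_sided n \<sigma>' \<and> (\<forall>i<n. \<forall>j<n. \<sigma>' {Inl i, Inr j} = z i)"
    and "\<exists>\<sigma>'. balanced_one_sided n \<sigma>' \<and> (\<forall>i<n. \<forall>j<n. \<sigma>' {Inl i, Inr j} = z j)"
proof -
  have z1: "z i \<in> {-1, 1}" if "i < n" for i
    using z that unfolding balanced_vector_def sign_vector_def by auto
  have outer: "outer n u v $$ (i, j) = u $ i * v $ j" if "i < n" "j < n" "dim_vec u = n" "dim_vec v = n" for u v i j
    using that by (simp add: outer_def scalar_prod_def mat_of_cols_def)
  have dim: "dim_row (outer n u v) = n" "dim_col (outer n u v) = n" for u v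
    by (simp_all add: outer_def)
  \<comment> \<open>\<open>THE\<close> reads off the index of the end in \<open>X\<close>, unique
    for an edge.\<close>
  define \<sigma>r where "\<sigma>r e = z (THE i. Inl i \<in> e)" for e :: "(nat + nat) set"
  have r: "\<sigma>r {Inl i, Inr j} = z i" for i j by (simp add: \<sigma>r_def)
  have "sign_matrix n \<sigma>r = outer n (vec n z) (ones_vec n)"
    by (rule eq_matI) (simp_all add: sign_matrix_def r outer dim ones_vec_def)
  moreover have "signing n \<sigma>r"
    unfolding signing_def
  proof
    fix e assume "e \<in> Knn_edges n"
    then obtain i j where "e = {Inl i, Inr j}" "i < n" "j < n" unfolding Knn_edges_def by blast
    then show "\<sigma>r e \<in> {-1, 1}" using z1[of i] r by simp
  qed
  ultimately show "\<exists>\<sigma>'. balanced_one_sided n \<sigma>' \<and> (\<forall>i<n. \<forall>j<n. \<sigma>' {Inl i, Inr j} = z i)"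
    using z r unfolding balanced_one_sided_def by blast
  define \<sigma>c where "\<sigma>c e = z (THE j. Inr j \<in> e)" for e :: "(nat + nat) set"
  have c: "\<sigma>c {Inl i, Inr j} = z j" for i j by (simp add: \<sigma>c_def)
  have "sign_matrix n \<sigma>c = outer n (ones_vec n) (vec n z)"
    by (rule eq_matI) (simp_all add: sign_matrix_def c outer dim ones_vec_def)
  moreover have "signing n \<sigma>c"
    unfolding signing_def
  proof
    fix e assume "e \<in> Knn_edges n"
    then obtain i j where "e = {Inl i, Inr j}" "i < n" "j < n" unfolding Knn_edges_def by blast
    then show "\<sigma>c e \<in> {-1, 1}" using z1[of j] c by simp
  qed
  ultimately show "\<exists>\<sigma>'. balanced_one_sided n \<sigma>' \<and> (\<forall>i<n. \<forall>j<n. \<sigma>' {Inl i, Inr j} = z j)"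
    using z c unfolding balanced_one_sided_def by blast
qed

lemma eps_close_of_mismatches:
  assumes "mismatches n (\<lambda>i j. \<sigma> {Inl i, Inr j}) M \<le> \<epsilon> * (real n)\<^sup>2"
    and "\<forall>i<n. \<forall>j<n. \<sigma>' {Inl i, Inr j} = M i j"
  shows "eps_close \<epsilon> n \<sigma> \<sigma>'"
proof -
  have "{(i, j). i < n \<and> j < n \<and> sign_matrix n \<sigma> $$ (i, j) \<noteq> sign_matrix n \<sigma>' $$ (i, j)}
    = {(i, j). i < n \<and> j < n \<and> \<sigma> {Inl i, Inr j} \<noteq> M i j}"
    using assms(2) by (auto simp: sign_matrix_def)
  then show ?thesis using assms(1) unfolding eps_close_def mismatches_def by (simp only: card_pairs_eq_sum)
qed

lemma near_balanced_one_sided: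
  assumes \<sigma>: "signing n \<sigma>" and n: "n > 0" and \<epsilon>: "0 < \<epsilon>" "\<epsilon> \<le> 1"
    and few: "unbalanced_count n (\<lambda>i j. \<sigma> {Inl i, Inr j}) \<le> \<epsilon>\<^sup>2 / 32 * real n ^ 4"
    and small: "real_of_int \<bar>\<Sum>i<n. \<Sum>j<n. \<sigma> {Inl i, Inr j}\<bar> \<le> \<epsilon> / 2 * (real n)\<^sup>2"
  shows "\<exists>\<sigma>'. balanced_one_sided n \<sigma>' \<and> eps_close \<epsilon> n \<sigma> \<sigma>'"
proof -
  define M where "M i j = \<sigma> {Inl i, Inr j}" for i j :: nat
  have M: "M i j \<in> {-1, 1}" if "i < n" "j < n" for i j
    using \<sigma> that unfolding signing_def Knn_edges_def M_def by blast
  have "\<epsilon>\<^sup>2 \<le> \<epsilon>" using \<epsilon> by (simp add: power2_eq_square mult_left_le)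
  \<comment> \<open>The parameters are \<open>\<delta> = \<epsilon>^2 / 32\<close> and
    \<open>\<tau> = \<epsilon> / 4\<close>; after balancing the error is
    \<open>13 * \<epsilon> / 16\<close> times \<open>n^2\<close>.\<close>
  then have \<eta>: "\<epsilon>\<^sup>2 / 32 + \<epsilon> / 4 \<le> 9 * \<epsilon> / 32" "\<epsilon>\<^sup>2 / 32 / (\<epsilon> / 4) \<le> 9 * \<epsilon> / 32"
    using \<epsilon> by (simp_all add: power2_eq_square)
  obtain z where z: "\<forall>i<n. z i \<in> {-1, 1}"
    and near: "mismatches n M (\<lambda>i j. z i) \<le> 9 * \<epsilon> / 32 * (real n)\<^sup>2 \<or>
      mismatches n M (\<lambda>i j. z j) \<le> 9 * \<epsilon> / 32 * (real n)\<^sup>2"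
    using near_one_sided_if_few_unbalanced[OF n M few[folded M_def] _ _ \<eta>] \<epsilon> by auto
  have total: "(2 * (9 * \<epsilon> / 32) + \<epsilon> / 2 / 2) * (real n)\<^sup>2 \<le> \<epsilon> * (real n)\<^sup>2"
    using \<epsilon> by (intro mult_right_mono) auto
  have z: "z i \<in> {-1, 1}" if "i < n" for i using z that by simp
  from near show ?thesis
  proof
    assume near: "mismatches n M (\<lambda>i j. z i) \<le> 9 * \<epsilon> / 32 * (real n)\<^sup>2"
    obtain z' where z': "balanced_vector n (vec n z')"
      "mismatches n M (\<lambda>i j. z' i) \<le> (2 * (9 * \<epsilon> / 32) + \<epsilon> / 2 / 2) * (real n)\<^sup>2"
      using ex_balanced_near[OF M z near small[folded M_def] n] by blast
    obtain \<sigma>' where "balanced_one_sided n \<sigma>'" "\<forall>i<n. \<forall>j<n. \<sigma>' {Inl i, Inr j} = z' i"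
      using balanced_one_sided_of_balanced_vector(1)[OF z'(1)] by blast
    moreover from this have "eps_close \<epsilon> n \<sigma> \<sigma>'"
      using order_trans[OF z'(2) total] unfolding M_def by (intro eps_close_of_mismatches) auto
    ultimately show ?thesis by blast
  next
    assume near: "mismatches n M (\<lambda>i j. z j) \<le> 9 * \<epsilon> / 32 * (real n)\<^sup>2"
    \<comment> \<open>The case of constant columns is the case of constant rows for the transposed
      matrix.\<close>
    have Mt: "M j i \<in> {-1, 1}" if "i < n" "j < n" for i j using M that by blast
    have near_t: "mismatches n (\<lambda>i j. M j i) (\<lambda>i j. z i) \<le> 9 * \<epsilon> / 32 * (real n)\<^sup>2"
      using near mismatches_transpose[of n M "\<lambda>i j. z j"] by simp
    have small_t: "real_of_int \<bar>\<Sum>i<n. \<Sum>j<n. M j i\<bar> \<le> \<epsilon> / 2 * (real n)\<^sup>2"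
    proof -
      have "(\<Sum>i<n. \<Sum>j<n. M j i) = (\<Sum>i<n. \<Sum>j<n. M i j)" by (rule sum.swap)
      then show ?thesis using small[folded M_def] by simp
    qed
    obtain z' where z': "balanced_vector n (vec n z')"
      "mismatches n (\<lambda>i j. M j i) (\<lambda>i j. z' i) \<le> (2 * (9 * \<epsilon> / 32) + \<epsilon> / 2 / 2) * (real n)\<^sup>2"
      using ex_balanced_near[where M = "\<lambda>i j. M j i", OF Mt z near_t small_t n] by blast
    have "mismatches n M (\<lambda>i j. z' j) \<le> \<epsilon> * (real n)\<^sup>2"
      using order_trans[OF z'(2) total] mismatches_transpose[of n M "\<lambda>i j. z' j"] by simp
    moreover obtain \<sigma>' where "balanced_one_sided n \<sigma>'" "\<forall>i<n. \<forall>j<n. \<sigma>' {Inl i, Inr j} = z' j"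
      using balanced_one_sided_of_balanced_vector(2)[OF z'(1)] by blast
    moreover from calculation have "eps_close \<epsilon> n \<sigma> \<sigma>'"
      unfolding M_def by (intro eps_close_of_mismatches) auto
    ultimately show ?thesis by blast
  qed
qed

section \<open>Asymptotic thresholds and the final case distinction\<close>

lemma eventually_exp_small:
  assumes "s > 0"
  shows "\<forall>\<^sub>F m in sequentially. 2 * real m * exp (- (s\<^sup>2 * real m / 64)) < 1"
proof -
  define a where "a = s\<^sup>2 / 64"
  have "a > 0" using assms by (simp add: a_def)
  then have "\<forall>\<^sub>F m in sequentially. 2 * real m * exp (- (a * real m)) < 1"
    by real_asymp
  then show ?thesis by (simp add: a_def)
qed

theorem theorem1p1:
  fixes \<epsilon> :: real
  assumes "0 < \<epsilon>" and "\<epsilon> \<le> 1"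
  shows "\<exists>c::real. c \<ge> \<epsilon> ^ 4 / 640000 \<and>
    (\<forall>\<^sub>F n in sequentially. \<forall>\<sigma>. signing n \<sigma> \<longrightarrow>
      (\<exists>F. one_factorization (Knn_verts n) (Knn_edges n) F \<and> (\<forall>M\<in>F. discrepancy \<sigma> M \<ge> c)) \<or>
      (\<exists>\<sigma>'. balanced_one_sided n \<sigma>' \<and> eps_close \<epsilon> n \<sigma> \<sigma>'))"
proof -
  define c where "c = \<epsilon> ^ 4 / 640000"
  have \<epsilon>2: "0 < \<epsilon>\<^sup>2" "\<epsilon>\<^sup>2 \<le> 1" "\<epsilon>\<^sup>2 \<le> \<epsilon>"
    using assms by (simp_all add: power_le_one) (simp add: power2_eq_square mult_left_le)
  have "\<epsilon> ^ 4 = \<epsilon>\<^sup>2 * \<epsilon>\<^sup>2" by (simp flip: power_add)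
  \<comment> \<open>The bound by \<open>\<epsilon>^2 / 640000\<close> serves the exchange
    construction, \<open>\<epsilon> / 4\<close> the large-sum one, and \<open>c \<le> 1\<close>
    controls the term \<open>c * r\<close>.\<close>
  then have c: "0 \<le> c" "c \<le> \<epsilon>\<^sup>2 / 640000" "c \<le> \<epsilon> / 4" "c \<le> 1"
    using \<epsilon>2 mult_left_le[of "\<epsilon>\<^sup>2" "\<epsilon>\<^sup>2"] assms by (auto simp: c_def)
  have "\<forall>\<^sub>F m in sequentially. 2 * real m * exp (- ((\<epsilon>\<^sup>2 / 64)\<^sup>2 * real m / 64)) < 1"
    using \<epsilon>2 by (intro eventually_exp_small) auto
  then obtain m1 where m1: "\<And>m. m \<ge> m1 \<Longrightarrow> 2 * real m * exp (- ((\<epsilon>\<^sup>2 / 64)\<^sup>2 * real m / 64)) < 1"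
    by (auto simp: eventually_sequentially)
  have "\<forall>\<^sub>F n in sequentially. 2 * real n * exp (- ((\<epsilon> / 4)\<^sup>2 * real n / 64)) < 1"
    using assms by (intro eventually_exp_small) auto
  then obtain n1 where n1: "\<And>n. n \<ge> n1 \<Longrightarrow> 2 * real n * exp (- ((\<epsilon> / 4)\<^sup>2 * real n / 64)) < 1"
    by (auto simp: eventually_sequentially)
  \<comment> \<open>Makes \<open>\<epsilon>^2 * m\<close> at least 2000, which absorbs the additive
    constants in \<open>4 * q + r\<close>.\<close>
  define m2 where "m2 = nat \<lceil>2000 / \<epsilon>\<^sup>2\<rceil>"
  have "(\<exists>F. one_factorization (Knn_verts n) (Knn_edges n) F \<and> (\<forall>M\<in>F. discrepancy \<sigma> M \<ge> c)) \<or>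
      (\<exists>\<sigma>'. balanced_one_sided n \<sigma>' \<and> eps_close \<epsilon> n \<sigma> \<sigma>')"
    if n: "n \<ge> n1 + 2 * m1 + 2 * m2 + 9" and \<sigma>: "signing n \<sigma>" for n \<sigma>
  proof -
    \<comment> \<open>In the first two cases half of the threshold is given up to concentration,
      leaving \<open>\<epsilon> / 4\<close> and \<open>\<epsilon>^2 / 64\<close>.\<close>
    consider (sum) "real_of_int \<bar>\<Sum>i<n. \<Sum>j<n. \<sigma> {Inl i, Inr j}\<bar> \<ge> \<epsilon> / 2 * (real n)\<^sup>2"
      | (many) "unbalanced_count n (\<lambda>i j. \<sigma> {Inl i, Inr j}) \<ge> \<epsilon>\<^sup>2 / 32 * real n ^ 4"
      | (near) "real_of_int \<bar>\<Sum>i<n. \<Sum>j<n. \<sigma> {Inl i, Inr j}\<bar> \<le> \<epsilon> / 2 * (real n)\<^sup>2"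
        "unbalanced_count n (\<lambda>i j. \<sigma> {Inl i, Inr j}) \<le> \<epsilon>\<^sup>2 / 32 * real n ^ 4"
      by linarith
    then show ?thesis
    proof cases
      case sum
      have "real n * exp (- ((\<epsilon> / 4)\<^sup>2 * real n / 64)) \<le> 2 * real n * exp (- ((\<epsilon> / 4)\<^sup>2 * real n / 64))"
        by simp
      also have "\<dots> < 1" using n1[of n] n by simp
      finally obtain F where F: "one_factorization (Knn_verts n) (Knn_edges n) F"
        "\<forall>M\<in>F. discrepancy \<sigma> M \<ge> \<epsilon> / 2 - \<epsilon> / 4"
        using ex_factorization_of_large_sum[OF \<sigma> _ _ _ _ sum, of "\<epsilon> / 4"] assms n by auto
      have "c \<le> \<epsilon> / 2 - \<epsilon> / 4" using c(3) by simp
      then have "\<forall>M\<in>F. discrepancy \<sigma> M \<ge> c" using F(2) order_trans by blast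
      then show ?thesis using F(1) by blast
    next
      case many
      \<comment> \<open>Chosen so that \<open>n - r\<close> is 2 modulo 4, which makes
        \<open>m\<close> odd.\<close>
      define r where "r = (n + 2) mod 4"
      define m where "m = (n - r) div 2"
      have r: "r < 4" by (simp add: r_def)
      have "odd m \<and> n = 2 * m + r" unfolding m_def r_def using n by presburger
      then have m: "odd m" "n = 2 * m + r" by auto
      have mm: "m \<ge> m1" "m \<ge> m2" "m \<ge> 3" using m(2) n r by auto
      have "2000 / \<epsilon>\<^sup>2 \<le> m" using mm(2) unfolding m2_def by (simp add: nat_le_iff ceiling_le_iff)
      then have big: "2000 \<le> \<epsilon>\<^sup>2 * m" using \<epsilon>2 by (simp add: divide_le_eq mult.commute)
      define q where "q = \<lceil>c * n\<rceil>"
      have "real_of_int q \<le> c * n + 1" unfolding q_def by linarith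
      also have "c * n = c * (2 * m) + c * r" by (simp add: m(2) algebra_simps)
      also have "c * r \<le> 1 * 3" using c r by (intro mult_mono) auto
      also have "c * (2 * m) \<le> \<epsilon>\<^sup>2 / 640000 * (2 * m)" using c by (intro mult_right_mono) auto
      finally have qle: "real_of_int q \<le> \<epsilon>\<^sup>2 * m / 320000 + 4" by (simp add: mult.commute)
      have "\<exists>F. one_factorization (Knn_verts n) (Knn_edges n) F \<and> (\<forall>M\<in>F. discrepancy \<sigma> M \<ge> c)"
      proof (rule ex_factorization_of_many_unbalanced[OF m(1) _ m(2) _ _ m1[OF mm(1)] many])
        show "r \<le> m" using r mm by simp
        show "0 < \<epsilon>\<^sup>2 / 64" "\<epsilon>\<^sup>2 / 64 \<le> 1" using \<epsilon>2 by auto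
        have "0 \<le> c * real n" using c by simp
        then show "0 \<le> q" unfolding q_def by linarith
        \<comment> \<open>The left side is at most \<open>\<epsilon>^2 * m / 80000 + 19\<close>,
          which is below \<open>\<epsilon>^2 * m / 64\<close> because
          \<open>\<epsilon>^2 * m\<close> is at least 2000.\<close>
        show "real_of_int (4 * q + int r) \<le> (\<epsilon>\<^sup>2 / 32 - \<epsilon>\<^sup>2 / 64) * m"
          using qle big r by (simp add: algebra_simps)
        show "c * n \<le> real_of_int q" by (simp add: q_def)
      qed
      then show ?thesis ..
    next
      case near
      then show ?thesis using near_balanced_one_sided[OF \<sigma> _ assms] n by auto
    qed
  qed
  then have "\<forall>\<^sub>F n in sequentially. \<forall>\<sigma>. signing n \<sigma> \<longrightarrow>
      (\<exists>F. one_factorization (Knn_verts n) (Knn_edges n) F \<and> (\<forall>M\<in>F. discrepancy \<sigma> M \<ge> c)) \<or>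
      (\<exists>\<sigma>'. balanced_one_sided n \<sigma>' \<and> eps_close \<epsilon> n \<sigma> \<sigma>')"
    unfolding eventually_sequentially by blast
  moreover have "\<epsilon> ^ 4 / 640000 \<le> c" by (simp add: c_def)
  ultimately show ?thesis by blast
qed

end
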